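(* Let $a>0$. No bounded composition operator on the Paley-Wiener space $B^2_a$ has the positive shadowing property; that is, for every $c\in\mathbb{R}$ with $0<|c|\leq 1$ and every $d\in\mathbb{C}$, the composition operator $C_\phi f=f\circ\phi$ on $B^2_a$ with symbol $\phi(z)=cz+d$ does not have the positive shadowing property.
   Context: For $a>0$, the Paley-Wiener space $B^2_a$ is the Hilbert space of all entire functions of exponential type less than or equal to $a$ whose restriction to $\mathbb{R}$ belongs to $L^2(\mathbb{R})$, with inner product $\langle f,g\rangle=\int_{-\infty}^{\infty}f(t)\overline{g(t)}\,dt$ and norm $\|\cdot\|_a$. Convention: a (bounded) composition operator on $B^2_a$ means an operator $C_\phi f=f\circ\phi$ with symbol $\phi(z)=cz+d$, $z\in\mathbb{C}$, where $c\in\mathbb{R}$, $0<|c|\leq1$, $d\in\mathbb{C}$; it is known that these are exactly the symbols inducing bounded composition operators on $B^2_a$. Let $T$ be a continuous linear operator on a complex Banach space $E$, and let $\mathbb{N}$ denote the positive integers. For $\delta>0$, a $\delta$-pseudo-orbit of $T$ is a sequence $(x_n)_{n=1}^\infty$ in $E$ with $\|Tx_n-x_{n+1}\|\leq\delta$ for all $n\in\mathbb{N}$. $T$ has the positive shadowing property if for every $\varepsilon>0$ there exists $\delta>0$ such that for every $\delta$-pseudo-orbit $(x_n)_{n=1}^\infty$ of $T$ there exists $x\in E$ with $\|T^nx-x_n\|\leq\varepsilon$ for all $n\in\mathbb{N}$. *)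

theory Defs
  imports "HOL-Analysis.Analysis" "HOL-Library.Function_Algebras"
begin

text \<open>
  An entire function has exponential type at most \<open>a\<close> if its growth is
  \<open>O(exp ((a + \<epsilon>) |z|))\<close> for every \<open>\<epsilon> > 0\<close>.
\<close>

definition exponential_type_le :: "real \<Rightarrow> (complex \<Rightarrow> complex) \<Rightarrow> bool" where
  "exponential_type_le a f \<longleftrightarrow>
     (\<forall>\<epsilon>>0. \<exists>C. \<forall>z. norm (f z) \<le> C * exp ((a + \<epsilon>) * norm z))"

definition paley_wiener :: "real \<Rightarrow> (complex \<Rightarrow> complex) set" where
  "paley_wiener a =
     {f. f holomorphic_on UNIV \<and> exponential_type_le a f \<and>
         integrable lborel (\<lambda>t. (norm (f (complex_of_real t)))\<^sup>2)}"

definition pw_inner :: "(complex \<Rightarrow> complex) \<Rightarrow> (complex \<Rightarrow> complex) \<Rightarrow> complex" where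
  "pw_inner f g = (LINT t|lborel. f (complex_of_real t) * cnj (g (complex_of_real t)))"

text \<open>
  The inner product, hence the norm, depends on \<open>a\<close> only through the space on which
  it is considered.  Outside of it the value is meaningless, since
  the integral of a non-integrable function is \<open>0\<close>.
\<close>

definition pw_norm :: "(complex \<Rightarrow> complex) \<Rightarrow> real" where
  "pw_norm f = sqrt (Re (pw_inner f f))"

definition composition_op ::
    "(complex \<Rightarrow> complex) \<Rightarrow> (complex \<Rightarrow> complex) \<Rightarrow> (complex \<Rightarrow> complex)" where
  "composition_op \<phi> f = f \<circ> \<phi>"

text \<open>
  The space is given by its carrier \<open>E\<close> and its norm \<open>N\<close>, because the spaces
  \<open>paley_wiener a\<close> form a family indexed by \<open>a\<close> rather than a type.
  Sequences are indexed by the positive integers; the value at \<open>0\<close> is irrelevant.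
\<close>

definition pseudo_orbit ::
    "'v::ab_group_add set \<Rightarrow> ('v \<Rightarrow> real) \<Rightarrow> ('v \<Rightarrow> 'v) \<Rightarrow> real \<Rightarrow> (nat \<Rightarrow> 'v) \<Rightarrow> bool" where
  "pseudo_orbit E N T \<delta> x \<longleftrightarrow>
     (\<forall>n\<ge>1. x n \<in> E) \<and> (\<forall>n\<ge>1. N (T (x n) - x (n + 1)) \<le> \<delta>)"

definition positive_shadowing ::
    "'v::ab_group_add set \<Rightarrow> ('v \<Rightarrow> real) \<Rightarrow> ('v \<Rightarrow> 'v) \<Rightarrow> bool" where
  "positive_shadowing E N T \<longleftrightarrow>
     (\<forall>\<epsilon>>0. \<exists>\<delta>>0. \<forall>x. pseudo_orbit E N T \<delta> x \<longrightarrow>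
        (\<exists>y\<in>E. \<forall>n\<ge>1. N ((T ^^ n) y - x n) \<le> \<epsilon>))"

end

theory Submission
  imports Defs "HOL-Complex_Analysis.Complex_Analysis" "HOL-Probability.Sinc_Integral"
begin

text \<open>
  If \<open>\<bar>c\<bar> < 1\<close>, the operator has proper range (it lowers the exponential type to
  \<open>\<bar>c\<bar> a\<close>), while all its nonzero orbits grow like \<open>\<bar>c\<bar> powr (- n / 2)\<close>; so a single jump to
  a function of exact type \<open>a\<close> cannot be corrected.  If \<open>c = -1\<close>, the operator is an involution
  with a nonzero fixed function \<open>u\<close>, and the pseudo-orbit of the multiples \<open>n k u\<close> is unbounded
  whereas orbits are bounded.  If \<open>c = 1\<close>, functions of very small type are almost invariant in
  norm under the first \<open>N\<close> translations in either direction, which gives a tent-shaped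
  pseudo-orbit of height proportional to \<open>N\<close> starting and ending at \<open>0\<close>; but norms along orbits
  of translations are quasi-convex in time by the three lines theorem.

  The norm estimates on translates (the Plancherel-Polya inequality and the three lines
  inequality) are obtained without Fourier analysis: correlating \<open>f\<close> with a function on a bounded
  window gives an entire function of the same type that is bounded on horizontal lines by the
  Cauchy-Schwarz inequality, so the Phragmen-Lindelof principle applies to it.
\<close>

subsection \<open>Phragmen-Lindelof principles\<close>

text \<open>The maximum modulus principle is applied to \<open>F z ^ n / (z - p)\<close> on a large
  bounded piece of \<open>S\<close>. Dividing by \<open>z - p\<close> gives decay at infinity, and
  the distance of at least 1 keeps the frontier bound \<open>M ^ n\<close>. The price is the factor
  \<open>dist p z0\<close>, which disappears under n-th roots as n grows.\<close>

lemma phragmen_lindelof_bounded: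
  fixes F :: "complex \<Rightarrow> complex"
  assumes S: "closed S" "\<And>z. z \<in> S \<Longrightarrow> 1 \<le> dist p z"
    and hol: "F holomorphic_on interior S" and cont: "continuous_on S F"
    and M: "0 \<le> M" "\<And>z. z \<in> frontier S \<Longrightarrow> norm (F z) \<le> M"
    and B: "\<And>z. z \<in> S \<Longrightarrow> norm (F z) \<le> B"
    and z0: "z0 \<in> S"
  shows "norm (F z0) \<le> M"
proof (rule ccontr)
  define x where "x = norm (F z0)"
  define c where "c = inverse (dist p z0)"
  have dz0: "1 \<le> dist p z0" using S(2) z0 by blast
  have c0: "c > 0" unfolding c_def using dz0 by (intro positive_imp_inverse_positive) linarith
  have Sp: "z - p \<noteq> 0" if "z \<in> S" for z using S(2)[OF that] by auto
  have B0: "0 \<le> B" using B[OF z0] norm_ge_zero[of "F z0"] by linarith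
  have key: "x ^ n * c \<le> M ^ n" for n
  proof (rule field_le_epsilon)
    fix \<eta> :: real assume \<eta>: "\<eta> > 0"
    \<comment> \<open>This radius makes \<open>B ^ n / dist p z\<close> at most
      \<open>\<eta>\<close> on the outer circle.\<close>
    define R where "R = dist p z0 + B ^ n / \<eta> + 1"
    have R0: "R > 0" unfolding R_def using B0 \<eta> dz0 by (intro add_pos_pos add_pos_nonneg) auto
    define T where "T = S \<inter> cball z0 R"
    define h where "h = (\<lambda>z. F z ^ n / (z - p))"
    have T: "closed T" "bounded T" "T \<subseteq> S" "z0 \<in> T"
      unfolding T_def using S(1) z0 R0 by (auto simp: bounded_Int)
    have "norm (h z0) \<le> M ^ n + \<eta>"
    proof (rule maximum_modulus_frontier[where S = T and f = h and \<xi> = z0])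
      have "interior T \<subseteq> interior S" using T(3) interior_mono by blast
      then show "h holomorphic_on interior T"
        unfolding h_def using Sp interior_subset[of S]
        by (intro holomorphic_intros holomorphic_on_subset[OF hol]) auto
      show "continuous_on (closure T) h"
        unfolding h_def closure_closed[OF T(1)] using Sp T(3)
        by (intro continuous_intros continuous_on_subset[OF cont]) auto
      fix z assume z: "z \<in> frontier T"
      have zT: "z \<in> T" using z T(1) frontier_subset_closed by blast
      have zS: "z \<in> S" and d1: "1 \<le> dist p z" using zT T(3) S(2) by auto
      have e: "norm (h z) = norm (F z) ^ n / dist p z"
        unfolding h_def by (simp add: norm_divide norm_power dist_norm norm_minus_commute)
      consider "z \<in> frontier S" | "z \<in> frontier (cball z0 R)"
        using z frontier_Int_subset[of S "cball z0 R"] unfolding T_def by blast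
      then show "norm (h z) \<le> M ^ n + \<eta>"
      proof cases
        case f: 1
        have "norm (F z) ^ n / dist p z \<le> M ^ n / 1"
          using M(2)[OF f] d1 M(1) by (intro frac_le power_mono) auto
        then show ?thesis using e \<eta> by simp
      next
        case f: 2
        have "dist z0 z = R" using f R0 by auto
        moreover have "dist z0 z \<le> dist p z0 + dist p z" by (metis dist_triangle2 dist_commute)
        ultimately have d2: "B ^ n / \<eta> + 1 \<le> dist p z" unfolding R_def by linarith
        have "norm (F z) ^ n \<le> B ^ n" using B[OF zS] by (intro power_mono) auto
        also have "\<dots> = \<eta> * (B ^ n / \<eta>)" using \<eta> by simp
        also have "\<dots> \<le> \<eta> * dist p z" using d2 \<eta> by (intro mult_left_mono) auto
        finally have "norm (F z) ^ n / dist p z \<le> \<eta>" using d1 \<eta> by (simp add: divide_le_eq)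
        then show ?thesis using e M(1) by (simp add: add_increasing)
      qed
    qed (use T in auto)
    moreover have "norm (h z0) = x ^ n / dist p z0"
      unfolding h_def x_def by (simp add: norm_divide norm_power dist_norm norm_minus_commute)
    ultimately show "x ^ n * c \<le> M ^ n + \<eta>" unfolding c_def by (simp only: divide_inverse)
  qed
  assume "\<not> norm (F z0) \<le> M"
  then have xM: "M < x" unfolding x_def by simp
  with M(1) have x0: "0 < x" by linarith
  \<comment> \<open>By \<open>key\<close>, the powers of \<open>M / x\<close> never drop below
    \<open>c\<close>, which is impossible for a ratio below 1.\<close>
  have "M / x < 1" using xM x0 by simp
  then obtain n where "(M / x) ^ n < c" using real_arch_pow_inv[OF c0] by blast
  then have "M ^ n < x ^ n * c" using x0 by (simp add: power_divide divide_less_eq mult.commute)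
  with key[of n] show False by simp
qed

text \<open>With p and q the real and imaginary parts of \<open>v\<close>, the cube has real part p
  (p^2 - 3 q^2), and q^2 is at most p^2 / 4. This makes the damping factor of the sector principle
  decay.\<close>

lemma Re_cube_ge:
  fixes v :: complex
  assumes "0 \<le> Re v" "2 * \<bar>Im v\<bar> \<le> Re v"
  shows "(Re v) ^ 3 / 4 \<le> Re (v ^ 3)"
proof -
  have "4 * (Im v)\<^sup>2 \<le> (Re v)\<^sup>2"
    using power_mono[OF assms(2), of 2] by (simp add: power_mult_distrib)
  then have "Re v * (4 * (Im v)\<^sup>2) \<le> Re v * (Re v)\<^sup>2" using assms(1) by (rule mult_left_mono)
  moreover have "Re (v ^ 3) = Re v ^ 3 - 3 * (Re v * (Im v)\<^sup>2)"
    by (simp add: power3_eq_cube power2_eq_square algebra_simps)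
  ultimately show ?thesis by (simp add: power3_eq_cube power2_eq_square algebra_simps)
qed

text \<open>The root halves the argument, from at most pi/4 to at most pi/8, and tan (pi/8) = sqrt 2
  - 1 is below 1/2. The proof avoids angles: if p < 2 q, the real part p^2 - q^2 of the square is
  less than 2 p q, the absolute value of its imaginary part.\<close>

lemma csqrt_sector:
  assumes "\<bar>Im w\<bar> \<le> Re w"
  shows "2 * \<bar>Im (csqrt w)\<bar> \<le> Re (csqrt w)"
proof -
  define p q where "p = Re (csqrt w)" and "q = \<bar>Im (csqrt w)\<bar>"
  have p0: "0 \<le> p" unfolding p_def using csqrt_principal[of w] by auto
  have w: "w = (csqrt w)\<^sup>2" by simp
  have re: "Re w = p\<^sup>2 - q\<^sup>2" unfolding p_def q_def by (subst w) (simp only: Re_power2, simp)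
  have im: "\<bar>Im w\<bar> = 2 * p * q"
    unfolding p_def q_def using p0 by (subst w) (simp only: Im_power2, simp add: abs_mult p_def)
  have "2 * p * q \<le> p\<^sup>2 - q\<^sup>2" using assms re im by simp
  moreover have "p\<^sup>2 - q\<^sup>2 < 2 * p * q" if "p < 2 * q"
  proof -
    have "q > 0" using that p0 by linarith
    have "p * (p - 2 * q) \<le> 0" using that p0 by (simp add: mult_nonneg_nonpos)
    moreover have "q * q > 0" using \<open>q > 0\<close> by simp
    ultimately show ?thesis by (simp add: power2_eq_square algebra_simps)
  qed
  ultimately show ?thesis unfolding p_def[symmetric] q_def[symmetric] by linarith
qed

text \<open>
  The damping factor \<open>exp (- \<delta> w powr (3/2))\<close> with \<open>w = z + 1\<close> beats order one
  because the exponent \<open>3/2\<close> exceeds \<open>1\<close>, and it stays bounded on the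
  sector of opening \<open>\<pi>/2\<close> because \<open>3/2 < 2\<close>.
\<close>

lemma phragmen_lindelof_sector:
  fixes H :: "complex \<Rightarrow> complex"
  assumes hol: "H holomorphic_on UNIV"
    and gr: "\<And>z. norm (H z) \<le> C * exp (b * norm z)" and b: "0 \<le> b"
    and K: "\<And>z. \<bar>Im z\<bar> = Re z \<Longrightarrow> norm (H z) \<le> K"
    and z0: "\<bar>Im z0\<bar> \<le> Re z0"
  shows "norm (H z0) \<le> K"
proof -
  define S where "S = {z. \<bar>Im z\<bar> \<le> Re z}"
  define v where "v = (\<lambda>z. csqrt (z + 1))"
  have K0: "0 \<le> K" using K[of 0] norm_ge_zero[of "H 0"] by (simp del: norm_ge_zero) 
  have C0: "0 \<le> C" using gr[of 0] norm_ge_zero[of "H 0"] by (simp del: norm_ge_zero) 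
  have S: "closed S" unfolding S_def by (intro closed_Collect_le continuous_intros)
  have int: "interior S \<subseteq> {z. \<bar>Im z\<bar> < Re z}"
  proof
    fix z assume "z \<in> interior S"
    then obtain e where e: "e > 0" "ball z e \<subseteq> S" using mem_interior by blast
    \<comment> \<open>An interior point can be moved to the left within \<open>S\<close>, so its
      inequality is strict.\<close>
    have "z - of_real (e / 2) \<in> S" using e by (intro set_mp[OF e(2)]) (simp add: dist_norm)
    then show "z \<in> {z. \<bar>Im z\<bar> < Re z}" using e(1) unfolding S_def by simp
  qed
  have fr: "\<bar>Im z\<bar> = Re z" if "z \<in> frontier S" for z
  proof -
    have "open {z. \<bar>Im z\<bar> < Re z}" by (intro open_Collect_less continuous_intros)
    then have "{z. \<bar>Im z\<bar> < Re z} \<subseteq> interior S" unfolding S_def by (intro interior_maximal) auto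
    moreover have "z \<in> S" "z \<notin> interior S"
      using that S by (auto simp: frontier_def)
    ultimately show ?thesis unfolding S_def by force
  qed
  have v: "0 \<le> Re (v z)" "2 * \<bar>Im (v z)\<bar> \<le> Re (v z)" if "z \<in> S" for z
    unfolding v_def using that csqrt_principal[of "z+1"] csqrt_sector[of "z+1"] by (auto simp: S_def)
  have v3: "Re (v z) ^ 3 / 4 \<le> Re (v z ^ 3)" if "z \<in> S" for z
    using v[OF that] by (rule Re_cube_ge)
  have slit: "z + 1 \<notin> \<real>\<^sub>\<le>\<^sub>0" if "z \<in> S" for z
    using that by (auto simp: S_def complex_nonpos_Reals_iff)
  \<comment> \<open>The global bound \<open>B\<close> may depend on \<open>\<delta>\<close>, since
    the principle for bounded functions retains only the frontier bound \<open>K\<close>.\<close>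
  have damped: "norm (H z0 * exp (- of_real \<delta> * v z0 ^ 3)) \<le> K" if \<delta>: "\<delta> > 0" for \<delta> :: real
  proof (rule phragmen_lindelof_bounded[where S = S and p = "-1"
            and F = "\<lambda>z. H z * exp (- of_real \<delta> * v z ^ 3)"
            and B = "C * exp (b * (5/4 * (5 * b / \<delta>)\<^sup>2 + 1))"])
    show "1 \<le> dist (-1) z" if "z \<in> S" for z
    proof -
      have "0 \<le> Re z" using that by (auto simp: S_def)
      then have "1 \<le> \<bar>Re (-1 - z)\<bar>" by simp
      also have "\<dots> \<le> dist (-1) z" unfolding dist_norm by (rule abs_Re_le_cmod)
      finally show ?thesis .
    qed
    show "(\<lambda>z. H z * exp (- of_real \<delta> * v z ^ 3)) holomorphic_on interior S"
      unfolding v_def using slit interior_subset[of S]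
      by (intro holomorphic_intros holomorphic_on_subset[OF hol]) auto
    show "continuous_on S (\<lambda>z. H z * exp (- of_real \<delta> * v z ^ 3))"
      unfolding v_def using slit
      by (intro holomorphic_on_imp_continuous_on holomorphic_intros holomorphic_on_subset[OF hol]) auto
    have E1: "norm (H z * exp (- of_real \<delta> * v z ^ 3)) \<le> norm (H z) * exp (- \<delta> / 4 * Re (v z) ^ 3)"
      if "z \<in> S" for z
      using v3[OF that] \<delta> by (auto simp: norm_mult intro!: mult_left_mono)
    show "norm (H z * exp (- of_real \<delta> * v z ^ 3)) \<le> K" if "z \<in> frontier S" for z
    proof -
      have zS: "z \<in> S" using that S frontier_subset_closed by blast
      have "norm (H z) * exp (- \<delta> / 4 * Re (v z) ^ 3) \<le> K * 1"
        using K[OF fr[OF that]] v(1)[OF zS] \<delta> K0 by (intro mult_mono) auto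
      with E1[OF zS] show ?thesis by simp
    qed
    show "norm (H z * exp (- of_real \<delta> * v z ^ 3)) \<le> C * exp (b * (5/4 * (5 * b / \<delta>)\<^sup>2 + 1))"
      if zS: "z \<in> S" for z
    proof -
      define p where "p = Re (v z)"
      have p0: "0 \<le> p" unfolding p_def by (rule v(1)[OF zS])
      have "norm z \<le> norm (z + 1) + 1" by (metis add_diff_cancel norm_one norm_triangle_ineq4)
      also have "norm (z + 1) = norm (v z) ^ 2"
        unfolding v_def by (simp add: norm_power[symmetric])
      also have "\<dots> = p\<^sup>2 + (Im (v z))\<^sup>2" unfolding p_def by (rule cmod_power2)
      also have "(Im (v z))\<^sup>2 \<le> p\<^sup>2 / 4"
        using power_mono[OF v(2)[OF zS], of 2] unfolding p_def by (simp add: power_mult_distrib)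
      finally have nz: "norm z \<le> 5/4 * p\<^sup>2 + 1" by simp
      \<comment> \<open>The threshold \<open>5 * b / \<delta>\<close> is where the damping
        \<open>\<delta> / 4 * p ^ 3\<close> overtakes the growth
        \<open>b * (5/4 * p\<^sup>2)\<close>.\<close>
      have ex: "b * (5/4 * p\<^sup>2 + 1) - \<delta> / 4 * p ^ 3 \<le> b * (5/4 * (5 * b / \<delta>)\<^sup>2 + 1)"
      proof (cases "p \<le> 5 * b / \<delta>")
        case True
        then have "b * (5/4 * p\<^sup>2 + 1) \<le> b * (5/4 * (5 * b / \<delta>)\<^sup>2 + 1)"
          using p0 b by (intro mult_left_mono add_right_mono power_mono) auto
        moreover have "0 \<le> \<delta> / 4 * p ^ 3" using \<delta> p0 by simp
        ultimately show ?thesis by linarith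
      next
        case False
        then have "5 * b \<le> \<delta> * p" using \<delta> by (simp add: not_le divide_less_eq mult.commute)
        then have "5 * b * (p\<^sup>2 / 4) \<le> \<delta> * p * (p\<^sup>2 / 4)" by (intro mult_right_mono) auto
        then have "b * (5/4 * p\<^sup>2 + 1) - \<delta> / 4 * p ^ 3 \<le> b * 1"
          by (simp add: power3_eq_cube power2_eq_square algebra_simps)
        also have "\<dots> \<le> b * (5/4 * (5 * b / \<delta>)\<^sup>2 + 1)" using b by (intro mult_left_mono) auto
        finally show ?thesis .
      qed
      have "norm (H z) \<le> C * exp (b * (5/4 * p\<^sup>2 + 1))"
        using nz b C0 by (intro order.trans[OF gr] mult_left_mono) (auto intro!: mult_left_mono)
      then have "norm (H z) * exp (- \<delta> / 4 * p ^ 3)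
          \<le> C * exp (b * (5/4 * p\<^sup>2 + 1)) * exp (- \<delta> / 4 * p ^ 3)" by (rule mult_right_mono) simp
      also have "\<dots> = C * exp (b * (5/4 * p\<^sup>2 + 1) - \<delta> / 4 * p ^ 3)"
        by (simp add: mult.assoc mult_exp_exp)
      also have "\<dots> \<le> C * exp (b * (5/4 * (5 * b / \<delta>)\<^sup>2 + 1))" using ex C0 by (intro mult_left_mono) auto
      finally show ?thesis using E1[OF zS] unfolding p_def by linarith
    qed
  qed (use S K0 z0 in \<open>auto simp: S_def\<close>)
  \<comment> \<open>Letting \<open>\<delta>\<close> tend to 0 removes the damping factor.\<close>
  have "((\<lambda>\<delta>. norm (H z0 * exp (- of_real \<delta> * v z0 ^ 3))) \<longlongrightarrow> norm (H z0 * exp (- of_real 0 * v z0 ^ 3))) (at_right 0)"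
    by (intro tendsto_intros)
  moreover have "eventually (\<lambda>\<delta>. norm (H z0 * exp (- of_real \<delta> * v z0 ^ 3)) \<le> K) (at_right 0)"
    using damped by (auto simp: eventually_at_right_less intro: eventually_mono[OF eventually_at_right_less])
  ultimately show ?thesis using tendsto_upperbound[of _ _ "at_right (0::real)"] by fastforce
qed

text \<open>The factor \<open>exp (\<i> * of_real b * z)\<close> has modulus 1 on the real axis and
  cancels the growth of \<open>G\<close> on the positive imaginary axis. So \<open>F\<close> is
  bounded on the boundary of both upper quadrants, and the sector principle bounds it by the crude
  constant \<open>K\<close> inside them. The principle for bounded functions on the whole half plane
  then improves \<open>K\<close> to \<open>M\<close>.\<close>

lemma exponential_type_half_plane:
  fixes G :: "complex \<Rightarrow> complex"
  assumes hol: "G holomorphic_on UNIV"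
    and gr: "\<And>z. norm (G z) \<le> C * exp (b * norm z)" and b: "0 \<le> b"
    and M: "\<And>x::real. norm (G (of_real x)) \<le> M"
    and z0: "0 \<le> Im z0"
  shows "norm (G z0) \<le> M * exp (b * Im z0)"
proof -
  have C0: "0 \<le> C" using gr[of 0] norm_ge_zero[of "G 0"] by (simp del: norm_ge_zero)
  have M0: "0 \<le> M" using M[of 0] norm_ge_zero[of "G 0"] by (simp del: norm_ge_zero)
  define F where "F = (\<lambda>z. exp (\<i> * of_real b * z) * G z)"
  define K where "K = max M C"
  have nF: "norm (F z) = exp (- b * Im z) * norm (G z)" for z
    unfolding F_def by (simp add: norm_mult)
  have Fhol: "F holomorphic_on UNIV" unfolding F_def by (intro holomorphic_intros hol)
  have Fgr: "norm (F z) \<le> C * exp (2 * b * norm z)" for z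
  proof -
    have "- b * Im z \<le> b * norm z" using b abs_Im_le_cmod[of z] mult_left_mono[of "- Im z" "norm z" b] by auto
    then have "norm (F z) \<le> exp (b * norm z) * (C * exp (b * norm z))"
      unfolding nF using C0 by (intro mult_mono gr) auto
    then show ?thesis by (simp add: mult_exp_exp algebra_simps)
  qed
  have Freal: "norm (F z) \<le> M" if "Im z = 0" for z
  proof -
    have "z = of_real (Re z)" using that by (simp add: complex_eq_iff)
    then show ?thesis using M[of "Re z"] that unfolding nF by simp
  qed
  have Fimag: "norm (F z) \<le> C" if "Re z = 0" "Im z \<ge> 0" for z
  proof -
    have "norm z = Im z" using that by (simp add: cmod_def)
    then have "norm (F z) \<le> exp (- b * Im z) * (C * exp (b * Im z))"
      unfolding nF using gr[of z] by (intro mult_left_mono) auto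
    then show ?thesis by (simp add: exp_minus field_simps)
  qed
  have quadrant: "norm (F (\<omega> * w)) \<le> K"
    if \<omega>: "\<omega> = 1 + \<i> \<or> \<omega> = -1 + \<i>" and w: "\<bar>Im w\<bar> \<le> Re w" for \<omega> w
  proof (rule phragmen_lindelof_sector[where H = "\<lambda>w. F (\<omega> * w)" and b = "2 * b * norm \<omega>" and C = C])
    show "(\<lambda>w. F (\<omega> * w)) holomorphic_on UNIV"
      by (rule holomorphic_on_compose_gen[OF _ Fhol, unfolded o_def]) (auto intro!: holomorphic_intros)
    show "norm (F (\<omega> * z)) \<le> C * exp (2 * b * norm \<omega> * norm z)" for z
      using Fgr[of "\<omega> * z"] by (simp add: norm_mult mult.assoc)
    show "norm (F (\<omega> * z)) \<le> K" if z: "\<bar>Im z\<bar> = Re z" for z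
    proof -
      have "Im (\<omega> * z) = 0 \<or> Re (\<omega> * z) = 0 \<and> Im (\<omega> * z) \<ge> 0"
        using \<omega> z by (auto simp: abs_if split: if_splits)
      then show ?thesis unfolding K_def using Freal Fimag by (auto simp: le_max_iff_disj)
    qed
  qed (use b w in auto)
  have upper: "norm (F z) \<le> K" if z: "0 \<le> Im z" for z
  proof -
    \<comment> \<open>Multiplication by \<open>\<omega>\<close> turns the sector around the positive
      real axis onto one quadrant of the upper half plane; as \<open>\<omega>\<close> has squared
      modulus 2, its inverse is \<open>cnj \<omega> / 2\<close>.\<close>
    define \<omega> where "\<omega> = (if Re z \<ge> 0 then 1 + \<i> else -1 + \<i>)"
    define w where "w = cnj \<omega> * z / 2"
    have "\<omega> * w = z" unfolding w_def \<omega>_def by (auto simp: complex_eq_iff algebra_simps)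
    moreover have "\<bar>Im w\<bar> \<le> Re w" unfolding w_def \<omega>_def using z by (auto simp: abs_if field_simps)
    ultimately show ?thesis using quadrant[of \<omega> w] by (auto simp: \<omega>_def split: if_splits)
  qed
  \<comment> \<open>Once \<open>F\<close> is known to be bounded, the imaginary axis no longer
    counts: the frontier of the half plane is the real axis alone.\<close>
  have "norm (F z0) \<le> M"
  proof (rule phragmen_lindelof_bounded[where S = "{z. Im z \<ge> 0}" and p = "- \<i>" and B = K
        and F = F and ?z0.0 = z0])
    show "closed {z. Im z \<ge> 0}" by (rule closed_halfspace_Im_ge)
    show "1 \<le> dist (- \<i>) z" if "z \<in> {z. Im z \<ge> 0}" for z
    proof -
      have "1 \<le> \<bar>Im (- \<i> - z)\<bar>" using that by simp
      also have "\<dots> \<le> dist (- \<i>) z" unfolding dist_norm by (rule abs_Im_le_cmod)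
      finally show ?thesis .
    qed
    show "norm (F z) \<le> M" if "z \<in> frontier {z. Im z \<ge> 0}" for z
    proof -
      have "{z. Im z > 0} \<subseteq> interior {z. Im z \<ge> 0}"
        by (intro interior_maximal open_halfspace_Im_gt) auto
      then have "Im z = 0" using that frontier_subset_closed[OF closed_halfspace_Im_ge[of 0]]
        by (force simp: frontier_def)
      then show ?thesis by (rule Freal)
    qed
  qed (use z0 M0 upper Fhol in \<open>auto intro: holomorphic_on_subset holomorphic_on_imp_continuous_on\<close>)
  then have "exp (b * Im z0) * norm (F z0) \<le> exp (b * Im z0) * M" by (intro mult_left_mono) auto
  then show ?thesis unfolding nF by (simp add: exp_minus mult.commute field_simps)
qed

lemma exponential_type_bounded:
  fixes G :: "complex \<Rightarrow> complex"
  assumes hol: "G holomorphic_on UNIV"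
    and gr: "\<And>z. norm (G z) \<le> C * exp (b * norm z)" and b: "0 \<le> b"
    and M: "\<And>x::real. norm (G (of_real x)) \<le> M"
  shows "norm (G z) \<le> M * exp (b * \<bar>Im z\<bar>)"
proof (cases "0 \<le> Im z")
  case True
  then show ?thesis using exponential_type_half_plane[OF assms True] by simp
next
  case False
  have "norm (G (- (- z))) \<le> M * exp (b * Im (- z))"
  proof (rule exponential_type_half_plane[where G = "\<lambda>z. G (- z)" and C = C])
    show "(\<lambda>z. G (- z)) holomorphic_on UNIV"
      by (rule holomorphic_on_compose_gen[OF _ hol, unfolded o_def]) (auto intro!: holomorphic_intros)
    show "norm (G (- complex_of_real x)) \<le> M" for x using M[of "- x"] by simp
  qed (use gr[of "- _"] b False in auto)
  then show ?thesis using False by simp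
qed

subsection \<open>The norm on the real line\<close>

abbreviation square_integrable_on_line :: "(complex \<Rightarrow> complex) \<Rightarrow> bool" where
  "square_integrable_on_line f \<equiv> integrable lborel (\<lambda>t. (norm (f (complex_of_real t)))\<^sup>2)"

lemma Re_pw_inner_self: "Re (pw_inner f f) = (LINT t|lborel. (norm (f (complex_of_real t)))\<^sup>2)"
proof -
  have "pw_inner f f = (LINT t|lborel. complex_of_real ((norm (f (complex_of_real t)))\<^sup>2))"
    unfolding pw_inner_def by (simp only: complex_norm_square)
  then show ?thesis by (simp only: integral_complex_of_real Re_complex_of_real)
qed

lemma pw_norm_power2: "(pw_norm f)\<^sup>2 = (LINT t|lborel. (norm (f (complex_of_real t)))\<^sup>2)"
  unfolding pw_norm_def Re_pw_inner_self by (simp add: integral_nonneg_AE)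

lemma pw_norm_nonneg: "0 \<le> pw_norm f"
  unfolding pw_norm_def Re_pw_inner_self by (simp add: integral_nonneg_AE)

lemma pw_norm_scale: "pw_norm (\<lambda>z. k * f z) = norm k * pw_norm f"
proof -
  have "(pw_norm (\<lambda>z. k * f z))\<^sup>2 = (norm k * pw_norm f)\<^sup>2"
    unfolding power_mult_distrib pw_norm_power2 by (simp add: norm_mult power_mult_distrib)
  then show ?thesis by (subst (asm) power2_eq_iff_nonneg) (auto simp: pw_norm_nonneg)
qed

lemma square_integrable_affine_iff:
  assumes "c \<noteq> 0"
  shows "square_integrable_on_line (\<lambda>z. f (of_real r + of_real c * z)) \<longleftrightarrow> square_integrable_on_line f"
  using lborel_integrable_real_affine_iff[OF assms, of "\<lambda>t. (norm (f (complex_of_real t)))\<^sup>2" r] by simp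

lemma pw_norm_affine:
  assumes "c \<noteq> 0"
  shows "(pw_norm f)\<^sup>2 = \<bar>c\<bar> * (pw_norm (\<lambda>z. f (of_real r + of_real c * z)))\<^sup>2"
  unfolding pw_norm_power2
  using lborel_integral_real_affine[OF assms, of "\<lambda>t. (norm (f (complex_of_real t)))\<^sup>2" r] by simp

lemma pw_norm_translate_real: "pw_norm (\<lambda>z. f (of_real r + z)) = pw_norm f"
  using pw_norm_affine[of 1 f r] pw_norm_nonneg by (simp add: power2_eq_iff_nonneg)

text \<open>The two translates differ by a real shift, which preserves Lebesgue measure. A bound on
  a whole horizontal line thus reduces to a bound at one of its points.\<close>

lemma pw_norm_translate_cong:
  assumes "Im w = Im w'"
  shows "pw_norm (\<lambda>z. f (w + z)) = pw_norm (\<lambda>z. f (w' + z))"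
proof -
  have "w + z = w' + (of_real (Re w - Re w') + z)" for z
    using assms by (simp add: complex_eq_iff)
  then have "(\<lambda>z. f (w + z)) = (\<lambda>z. f (w' + (of_real (Re w - Re w') + z)))" by (simp only:)
  then show ?thesis using pw_norm_translate_real[of "\<lambda>z. f (w' + z)" "Re w - Re w'"] by (simp only:)
qed

lemma continuous_on_line:
  "continuous_on UNIV f \<Longrightarrow> continuous_on A (\<lambda>t. f (z + complex_of_real t))"
  by (rule continuous_on_compose2[of UNIV f]) (auto intro!: continuous_intros)

text \<open>Integrating a pointwise inequality replaces Minkowski's inequality; the lost constant is
  harmless in the contradictions below.\<close>

lemma pw_norm_add_le:
  assumes "continuous_on UNIV f" "continuous_on UNIV g"
    and f: "square_integrable_on_line f" and g: "square_integrable_on_line g"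
  shows "square_integrable_on_line (\<lambda>z. f z + g z)"
    and "(pw_norm (\<lambda>z. f z + g z))\<^sup>2 \<le> 2 * (pw_norm f)\<^sup>2 + 2 * (pw_norm g)\<^sup>2"
proof -
  have le: "(norm (x + y))\<^sup>2 \<le> 2 * (norm x)\<^sup>2 + 2 * (norm y)\<^sup>2" for x y :: complex
  proof -
    have "(norm (x + y))\<^sup>2 \<le> (norm x + norm y)\<^sup>2" by (intro power_mono norm_triangle_ineq) auto
    also have "\<dots> \<le> 2 * (norm x)\<^sup>2 + 2 * (norm y)\<^sup>2"
      using zero_le_power2[of "norm x - norm y"] by (simp add: power2_eq_square algebra_simps)
    finally show ?thesis .
  qed
  have I: "integrable lborel (\<lambda>t. 2 * (norm (f (complex_of_real t)))\<^sup>2 + 2 * (norm (g (complex_of_real t)))\<^sup>2)"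
    using f g by simp
  have "continuous_on UNIV (\<lambda>t. f (0 + complex_of_real t))" "continuous_on UNIV (\<lambda>t. g (0 + complex_of_real t))"
    by (rule continuous_on_line, fact)+
  then have "(\<lambda>t. (norm (f (complex_of_real t) + g (complex_of_real t)))\<^sup>2) \<in> borel_measurable borel"
    by (intro borel_measurable_continuous_onI continuous_intros) auto
  then have "(\<lambda>t. (norm (f (complex_of_real t) + g (complex_of_real t)))\<^sup>2) \<in> borel_measurable lborel"
    by simp
  then show J: "square_integrable_on_line (\<lambda>z. f z + g z)"
    using le by (intro Bochner_Integration.integrable_bound[OF I]) auto
  show "(pw_norm (\<lambda>z. f z + g z))\<^sup>2 \<le> 2 * (pw_norm f)\<^sup>2 + 2 * (pw_norm g)\<^sup>2"
  proof -
    have "(LINT t|lborel. (norm (f (complex_of_real t) + g (complex_of_real t)))\<^sup>2)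
      \<le> (LINT t|lborel. 2 * (norm (f (complex_of_real t)))\<^sup>2 + 2 * (norm (g (complex_of_real t)))\<^sup>2)"
      using I J le by (intro integral_mono) auto
    then show ?thesis unfolding pw_norm_power2 using f g by simp
  qed
qed

text \<open>The integral of the square of s f - g is a nonnegative quadratic polynomial in s. Its
  minimum is at \<open>s = I / P\<close>; for \<open>P = 0\<close> it is affine in s, so its slope
  must vanish.\<close>

lemma Cauchy_Schwarz_interval:
  fixes f g :: "real \<Rightarrow> real"
  assumes f: "continuous_on {a..b} f" and g: "continuous_on {a..b} g"
  shows "(integral {a..b} (\<lambda>t. f t * g t))\<^sup>2
    \<le> integral {a..b} (\<lambda>t. (f t)\<^sup>2) * integral {a..b} (\<lambda>t. (g t)\<^sup>2)"
proof -
  define P Q I where "P = integral {a..b} (\<lambda>t. (f t)\<^sup>2)" and "Q = integral {a..b} (\<lambda>t. (g t)\<^sup>2)"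
    and "I = integral {a..b} (\<lambda>t. f t * g t)"
  have int: "(\<lambda>t. (f t)\<^sup>2) integrable_on {a..b}" "(\<lambda>t. (g t)\<^sup>2) integrable_on {a..b}"
    "(\<lambda>t. f t * g t) integrable_on {a..b}"
    by (auto intro!: integrable_continuous_real continuous_intros f g)
  have P0: "0 \<le> P" unfolding P_def by (intro integral_nonneg int) auto
  have quad: "0 \<le> s\<^sup>2 * P - 2 * s * I + Q" for s
  proof -
    have "((\<lambda>t. s\<^sup>2 * (f t)\<^sup>2 - 2 * s * (f t * g t) + (g t)\<^sup>2) has_integral (s\<^sup>2 * P - 2 * s * I + Q)) {a..b}"
      unfolding P_def Q_def I_def
      by (intro has_integral_add has_integral_diff has_integral_mult_right integrable_integral int)
    then show ?thesis
    proof (rule has_integral_nonneg)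
      fix t
      have "s\<^sup>2 * (f t)\<^sup>2 - 2 * s * (f t * g t) + (g t)\<^sup>2 = (s * f t - g t)\<^sup>2"
        by (simp add: power2_eq_square algebra_simps)
      then show "0 \<le> s\<^sup>2 * (f t)\<^sup>2 - 2 * s * (f t * g t) + (g t)\<^sup>2" by simp
    qed
  qed
  have "I\<^sup>2 \<le> P * Q"
  proof (cases "P = 0")
    case True
    have "I = 0"
    proof (rule ccontr)
      assume "I \<noteq> 0"
      \<comment> \<open>At this s the affine function takes the value -1.\<close>
      then show False using quad[of "(Q + 1) / (2 * I)"] True by simp
    qed
    then show ?thesis using True by simp
  next
    case False
    then show ?thesis using quad[of "I / P"] P0 by (simp add: field_simps power2_eq_square)
  qed
  then show ?thesis unfolding P_def Q_def I_def .
qed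

subsection \<open>Translates of square integrable functions of exponential type\<close>

text \<open>A scalar stand-in for the family of translates of \<open>f\<close>, to which the
  Phragmen-Lindelof principles apply. The bounded window makes the integral converge and depend
  holomorphically on \<open>z\<close> before any decay of \<open>f\<close> off the real axis is
  known.\<close>

definition window_correlation :: "real \<Rightarrow> (real \<Rightarrow> complex) \<Rightarrow> (complex \<Rightarrow> complex) \<Rightarrow> complex \<Rightarrow> complex" where
  "window_correlation R h f z = integral {-R..R} (\<lambda>t. f (z + of_real t) * h t)"

lemma window_correlation_holomorphic:
  assumes "f holomorphic_on UNIV" "continuous_on UNIV h"
  shows "window_correlation R h f holomorphic_on UNIV"
proof -
  have cd: "continuous_on UNIV (deriv f)"
    using assms(1) by (intro holomorphic_on_imp_continuous_on holomorphic_deriv) auto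
  have "(\<lambda>z. integral (cbox (-R) R) (\<lambda>t. f (z + of_real t) * h t)) holomorphic_on UNIV"
  proof (rule leibniz_rule_holomorphic[where fx = "\<lambda>z t. deriv f (z + of_real t) * h t"])
    fix z :: complex and t :: real
    have "(f has_field_derivative deriv f (z + of_real t)) (at (z + of_real t))"
      using assms(1) by (intro holomorphic_derivI) auto
    then have "((\<lambda>z. f (z + of_real t)) has_field_derivative deriv f (z + of_real t)) (at z)"
      by (simp add: DERIV_shift)
    then show "((\<lambda>z. f (z + of_real t) * h t) has_field_derivative deriv f (z + of_real t) * h t) (at z within UNIV)"
      by (rule DERIV_cmult_right)
  next
    fix z
    show "(\<lambda>t. f (z + of_real t) * h t) integrable_on cbox (-R) R"
      by (intro integrable_continuous continuous_intros continuous_on_line holomorphic_on_imp_continuous_on assms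
            continuous_on_subset[OF assms(2)]) auto
  next
    show "continuous_on (UNIV \<times> cbox (- R) R) (\<lambda>(z, t). deriv f (z + of_real t) * h t)"
      unfolding split_beta
      by (intro continuous_intros continuous_on_compose2[OF cd] continuous_on_compose2[OF assms(2)]) auto
  qed auto
  then show ?thesis by (simp add: window_correlation_def[abs_def])
qed

lemma integral_window_le_pw_norm:
  assumes f: "continuous_on UNIV f" and int: "square_integrable_on_line (\<lambda>u. f (z + u))"
  shows "integral {-R..R} (\<lambda>t. (norm (f (z + of_real t)))\<^sup>2) \<le> (pw_norm (\<lambda>u. f (z + u)))\<^sup>2"
proof -
  have "set_integrable lborel {-R..R} (\<lambda>t. (norm (f (z + of_real t)))\<^sup>2)"
    by (intro borel_integrable_atLeastAtMost' continuous_intros continuous_on_line f)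
  then have "integral {-R..R} (\<lambda>t. (norm (f (z + of_real t)))\<^sup>2)
      = (LINT t:{-R..R}|lborel. (norm (f (z + of_real t)))\<^sup>2)"
    and "integrable lborel (\<lambda>t. indicator {-R..R} t *\<^sub>R (norm (f (z + of_real t)))\<^sup>2)"
    by (simp_all add: set_borel_integral_eq_integral set_integrable_def)
  then show ?thesis unfolding pw_norm_power2 set_lebesgue_integral_def
    using int by (auto intro!: integral_mono simp: indicator_def)
qed

lemma window_correlation_le:
  assumes f: "continuous_on UNIV f" and h: "continuous_on UNIV h"
    and int: "square_integrable_on_line (\<lambda>u. f (z + u))"
  shows "norm (window_correlation R h f z)
    \<le> pw_norm (\<lambda>u. f (z + u)) * sqrt (integral {-R..R} (\<lambda>t. (norm (h t))\<^sup>2))"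
proof -
  have h': "continuous_on A h" for A using h by (rule continuous_on_subset) simp
  define Q where "Q = integral {-R..R} (\<lambda>t. (norm (h t))\<^sup>2)"
  have Q0: "0 \<le> Q" unfolding Q_def
    by (intro integral_nonneg integrable_continuous_real continuous_intros h') auto
  have "norm (window_correlation R h f z) \<le> integral {-R..R} (\<lambda>t. norm (f (z + of_real t)) * norm (h t))"
    unfolding window_correlation_def
    by (intro integral_norm_bound_integral integrable_continuous_real continuous_intros continuous_on_line f h')
      (auto simp: norm_mult)
  then have "(norm (window_correlation R h f z))\<^sup>2 \<le> (integral {-R..R} (\<lambda>t. norm (f (z + of_real t)) * norm (h t)))\<^sup>2"
    by (intro power_mono) auto
  also have "\<dots> \<le> integral {-R..R} (\<lambda>t. (norm (f (z + of_real t)))\<^sup>2) * Q"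
    unfolding Q_def by (intro Cauchy_Schwarz_interval continuous_intros continuous_on_line f h')
  also have "\<dots> \<le> (pw_norm (\<lambda>u. f (z + u)))\<^sup>2 * Q"
    using Q0 by (intro mult_right_mono integral_window_le_pw_norm f int)
  also have "\<dots> = (pw_norm (\<lambda>u. f (z + u)) * sqrt Q)\<^sup>2" using Q0 by (simp add: power_mult_distrib)
  finally show ?thesis
    unfolding Q_def[symmetric] by (rule power2_le_imp_le) (use Q0 pw_norm_nonneg in auto)
qed

text \<open>Moving the argument within the window costs at most the factor
  \<open>exp (b * R)\<close>. The resulting constant may depend on \<open>R\<close> and
  \<open>h\<close>, because \<open>exponential_type_bounded\<close> discards it and retains only the
  rate \<open>b\<close>.\<close>

lemma window_correlation_growth:
  assumes f: "continuous_on UNIV f" and h: "continuous_on UNIV h"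
    and gr: "\<And>z. norm (f z) \<le> C * exp (b * norm z)" and b: "0 \<le> b"
  shows "norm (window_correlation R h f z)
    \<le> (C * exp (b * R) * integral {-R..R} (\<lambda>t. norm (h t))) * exp (b * norm z)"
proof -
  have h': "continuous_on A h" for A using h by (rule continuous_on_subset) simp
  have C0: "0 \<le> C" using gr[of 0] norm_ge_zero[of "f 0"] by (simp del: norm_ge_zero)
  have pt: "norm (f (z + of_real t) * h t) \<le> C * exp (b * R) * exp (b * norm z) * norm (h t)"
    if t: "t \<in> {-R..R}" for t
  proof -
    have "norm (z + complex_of_real t) \<le> norm z + \<bar>t\<bar>" by (metis norm_triangle_ineq norm_of_real)
    also have "\<dots> \<le> R + norm z" using t by auto
    finally have "b * norm (z + complex_of_real t) \<le> b * R + b * norm z"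
      using b by (metis mult_left_mono distrib_left)
    then have "C * exp (b * norm (z + complex_of_real t)) \<le> C * (exp (b * R) * exp (b * norm z))"
      using C0 by (simp add: mult_exp_exp mult_left_mono)
    with gr[of "z + of_real t"] have "norm (f (z + of_real t)) \<le> C * exp (b * R) * exp (b * norm z)" by simp
    then show ?thesis unfolding norm_mult by (rule mult_right_mono) simp
  qed
  have "norm (window_correlation R h f z) \<le> integral {-R..R} (\<lambda>t. C * exp (b * R) * exp (b * norm z) * norm (h t))"
    unfolding window_correlation_def
    by (intro integral_norm_bound_integral integrable_continuous_real continuous_intros continuous_on_line f h' pt)
  then show ?thesis by (simp add: mult_ac)
qed

text \<open>
  Taking for \<open>h\<close> the conjugate of \<open>f (w + \<cdot>)\<close> turns a uniform bound on the
  correlations into a bound on the norm of \<open>f (w + \<cdot>)\<close>.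
\<close>

lemma pw_norm_le_by_correlations:
  assumes f: "continuous_on UNIV f" and K: "0 \<le> K"
    and corr: "\<And>R h. continuous_on UNIV h \<Longrightarrow> norm (window_correlation R h f w)
       \<le> K * sqrt (integral {-R..R} (\<lambda>t. (norm (h t))\<^sup>2))"
  shows "square_integrable_on_line (\<lambda>z. f (w + z))" and "pw_norm (\<lambda>z. f (w + z)) \<le> K"
proof -
  define g where "g = (\<lambda>t. (norm (f (w + complex_of_real t)))\<^sup>2)"
  have g: "continuous_on A g" for A unfolding g_def by (intro continuous_intros continuous_on_line f)
  define u where "u = (\<lambda>(n::nat) t. indicator {-real n..real n} t *\<^sub>R g t)"
  have set_int: "set_integrable lborel {-real n..real n} g" for n
    by (intro borel_integrable_atLeastAtMost' g)
  then have u_int: "integrable lborel (u n)" for n unfolding u_def set_integrable_def .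
  have u_eq: "integral\<^sup>L lborel (u n) = integral {-real n..real n} g" for n
    using set_borel_integral_eq_integral(2)[OF set_int, of n] unfolding u_def set_lebesgue_integral_def .
  have bound: "integral\<^sup>L lborel (u n) \<le> K\<^sup>2" for n
  proof -
    define Q where "Q = integral {-real n..real n} g"
    have Q0: "0 \<le> Q" unfolding Q_def
      by (intro integral_nonneg integrable_continuous_real g) (simp add: g_def)
    have "window_correlation (real n) (\<lambda>t. cnj (f (w + of_real t))) f w
        = integral {-real n..real n} (\<lambda>t. complex_of_real (g t))"
      unfolding window_correlation_def g_def by (simp only: complex_norm_square)
    also have "\<dots> = of_real Q" unfolding Q_def
      by (intro integral_unique has_integral_of_real integrable_integral integrable_continuous_real g)
    finally have "Q \<le> K * sqrt Q"
      using corr[of "\<lambda>t. cnj (f (w + of_real t))" "real n"] Q0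
      by (simp add: Q_def g_def continuous_on_line f continuous_on_cnj)
    then have "sqrt Q * sqrt Q \<le> K * sqrt Q" using Q0 by simp
    then have "sqrt Q \<le> K" using K Q0 mult_right_le_imp_le[of "sqrt Q" "sqrt Q" K]
      by (cases "Q = 0") simp_all
    then have "(sqrt Q)\<^sup>2 \<le> K\<^sup>2" using Q0 by (intro power_mono) auto
    then show ?thesis unfolding u_eq Q_def[symmetric] using Q0 by simp
  qed
  \<comment> \<open>The windows increase to the whole line, so monotone convergence yields
    integrability as well as the bound on the integral.\<close>
  have mono_u: "mono (\<lambda>n. u n t)" for t
    unfolding u_def by (intro monoI) (auto simp: indicator_def g_def)
  have "incseq (\<lambda>n. integral\<^sup>L lborel (u n))"
    using mono_u by (intro monoI integral_mono u_int) (auto dest: monoD)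
  then obtain L where L: "(\<lambda>n. integral\<^sup>L lborel (u n)) \<longlonglongrightarrow> L"
    using incseq_convergent bound by blast
  have lim: "(\<lambda>n. u n t) \<longlonglongrightarrow> g t" for t
  proof -
    obtain N :: nat where "\<bar>t\<bar> \<le> real N" using real_arch_simple by blast
    then have "u n t = g t" if "n \<ge> N" for n
      using that unfolding u_def by (auto simp: indicator_def)
    then show ?thesis by (intro tendsto_eventually eventually_sequentiallyI[of N])
  qed
  have meas: "g \<in> borel_measurable lborel"
    using borel_measurable_continuous_onI[OF g] by simp
  have "integrable lborel g" and eq: "integral\<^sup>L lborel g = L"
    using integrable_monotone_convergence[OF u_int _ _ L meas]
      integral_monotone_convergence[OF u_int _ _ L meas] mono_u lim by auto
  then show "square_integrable_on_line (\<lambda>z. f (w + z))" unfolding g_def by simp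
  have "L \<le> K\<^sup>2" using L bound by (intro LIMSEQ_le_const2[OF L]) auto
  then have "(pw_norm (\<lambda>z. f (w + z)))\<^sup>2 \<le> K\<^sup>2" unfolding pw_norm_power2 using eq by (simp add: g_def)
  then show "pw_norm (\<lambda>z. f (w + z)) \<le> K" using K by (rule power2_le_imp_le)
qed

text \<open>On the real axis every correlation is bounded by \<open>pw_norm f\<close> times the norm
  of \<open>h\<close>, by Cauchy-Schwarz. Being of exponential type, it exceeds this bound at
  \<open>w\<close> by the factor \<open>exp (b * \<bar>Im w\<bar>)\<close> at most. The estimate is
  uniform in \<open>R\<close> and \<open>h\<close>, so it passes to the norm of the
  translate.\<close>

lemma plancherel_polya:
  assumes hol: "f holomorphic_on UNIV"
    and gr: "\<And>z. norm (f z) \<le> C * exp (b * norm z)" and b: "0 \<le> b"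
    and int: "square_integrable_on_line f"
  shows "square_integrable_on_line (\<lambda>z. f (w + z))"
    and "pw_norm (\<lambda>z. f (w + z)) \<le> exp (b * \<bar>Im w\<bar>) * pw_norm f"
proof -
  have f: "continuous_on UNIV f" using hol by (rule holomorphic_on_imp_continuous_on)
  have K: "0 \<le> exp (b * \<bar>Im w\<bar>) * pw_norm f" using pw_norm_nonneg by simp
  have corr: "norm (window_correlation R h f w)
       \<le> exp (b * \<bar>Im w\<bar>) * pw_norm f * sqrt (integral {-R..R} (\<lambda>t. (norm (h t))\<^sup>2))"
    if h: "continuous_on UNIV h" for R h
  proof -
    have "norm (window_correlation R h f w)
       \<le> pw_norm f * sqrt (integral {-R..R} (\<lambda>t. (norm (h t))\<^sup>2)) * exp (b * \<bar>Im w\<bar>)"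
    proof (rule exponential_type_bounded)
      show "window_correlation R h f holomorphic_on UNIV"
        by (rule window_correlation_holomorphic[OF hol h])
      show "norm (window_correlation R h f z)
        \<le> (C * exp (b * R) * integral {-R..R} (\<lambda>t. norm (h t))) * exp (b * norm z)" for z
        by (rule window_correlation_growth[OF f h gr b])
      show "norm (window_correlation R h f (of_real x))
        \<le> pw_norm f * sqrt (integral {-R..R} (\<lambda>t. (norm (h t))\<^sup>2))" for x
        using window_correlation_le[OF f h, of "of_real x" R] int
          square_integrable_affine_iff[of 1 f x] pw_norm_translate_real[of f x] by simp
    qed (rule b)
    then show ?thesis by (simp add: mult_ac)
  qed
  show "square_integrable_on_line (\<lambda>z. f (w + z))"
    and "pw_norm (\<lambda>z. f (w + z)) \<le> exp (b * \<bar>Im w\<bar>) * pw_norm f"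
    using pw_norm_le_by_correlations[OF f K corr] by auto
qed

text \<open>The correlations are bounded in the strip by the Plancherel-Polya inequality, and on its
  edges by the larger of the two edge norms. The Phragmen-Lindelof principle carries the edge bound
  inside.\<close>

lemma pw_norm_three_lines:
  assumes hol: "f holomorphic_on UNIV"
    and gr: "\<And>z. norm (f z) \<le> C * exp (b * norm z)" and b: "0 \<le> b"
    and int: "square_integrable_on_line f"
    and w: "Im w1 \<le> Im w" "Im w \<le> Im w2"
  shows "pw_norm (\<lambda>z. f (w + z)) \<le> max (pw_norm (\<lambda>z. f (w1 + z))) (pw_norm (\<lambda>z. f (w2 + z)))"
    (is "_ \<le> ?K")
proof (rule pw_norm_le_by_correlations(2))
  show f: "continuous_on UNIV f" using hol by (rule holomorphic_on_imp_continuous_on)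
  show K: "0 \<le> ?K" using pw_norm_nonneg by (simp add: le_max_iff_disj)
  fix R h assume h: "continuous_on UNIV (h :: real \<Rightarrow> complex)"
  define q where "q = sqrt (integral {-R..R} (\<lambda>t. (norm (h t))\<^sup>2))"
  have h': "continuous_on A h" for A using h by (rule continuous_on_subset) simp
  have q0: "0 \<le> q" unfolding q_def
    by (intro real_sqrt_ge_zero integral_nonneg integrable_continuous_real continuous_intros h') auto
  define S where "S = {z. Im w1 \<le> Im z} \<inter> {z. Im z \<le> Im w2}"
  have S: "closed S" unfolding S_def by (intro closed_Int closed_halfspace_Im_ge closed_halfspace_Im_le)
  have hol': "window_correlation R h f holomorphic_on UNIV"
    by (rule window_correlation_holomorphic[OF hol h])
  have corr: "norm (window_correlation R h f z) \<le> pw_norm (\<lambda>u. f (z + u)) * q" for z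
    unfolding q_def by (intro window_correlation_le f h plancherel_polya[OF hol gr b int])
  \<comment> \<open>The point \<open>p\<close> lies one unit below the strip. Of the
    Plancherel-Polya bound \<open>B\<close> only the finiteness matters.\<close>
  have "norm (window_correlation R h f w) \<le> ?K * q"
  proof (rule phragmen_lindelof_bounded[where S = S and p = "Complex 0 (Im w1 - 1)"
          and F = "window_correlation R h f" and ?z0.0 = w
          and B = "exp (b * (\<bar>Im w1\<bar> + \<bar>Im w2\<bar>)) * pw_norm f * q"])
    show "1 \<le> dist (Complex 0 (Im w1 - 1)) z" if "z \<in> S" for z
    proof -
      have "1 \<le> \<bar>Im (Complex 0 (Im w1 - 1) - z)\<bar>" using that by (auto simp: S_def)
      also have "\<dots> \<le> dist (Complex 0 (Im w1 - 1)) z" unfolding dist_norm by (rule abs_Im_le_cmod)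
      finally show ?thesis .
    qed
    show "norm (window_correlation R h f z) \<le> ?K * q" if z: "z \<in> frontier S" for z
    proof -
      have "z \<in> S" using z S frontier_subset_closed by blast
      have "{z. Im w1 < Im z} \<inter> {z. Im z < Im w2} \<subseteq> interior S"
        unfolding S_def by (intro interior_maximal open_Int open_halfspace_Im_gt open_halfspace_Im_lt) auto
      then have "Im z = Im w1 \<or> Im z = Im w2"
        using z \<open>z \<in> S\<close> by (force simp: frontier_def S_def)
      then have "pw_norm (\<lambda>u. f (z + u)) \<le> ?K"
        using pw_norm_translate_cong[of z w1 f] pw_norm_translate_cong[of z w2 f] by auto
      with q0 have "pw_norm (\<lambda>u. f (z + u)) * q \<le> ?K * q" by (rule mult_right_mono[rotated])
      with corr[of z] show ?thesis by linarith
    qed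
    show "norm (window_correlation R h f z) \<le> exp (b * (\<bar>Im w1\<bar> + \<bar>Im w2\<bar>)) * pw_norm f * q"
      if z: "z \<in> S" for z
    proof -
      have "b * \<bar>Im z\<bar> \<le> b * (\<bar>Im w1\<bar> + \<bar>Im w2\<bar>)"
        using z b by (intro mult_left_mono) (auto simp: S_def)
      then have "exp (b * \<bar>Im z\<bar>) * pw_norm f \<le> exp (b * (\<bar>Im w1\<bar> + \<bar>Im w2\<bar>)) * pw_norm f"
        by (intro mult_right_mono) (auto simp: pw_norm_nonneg)
      with plancherel_polya(2)[OF hol gr b int, of z]
      have "pw_norm (\<lambda>u. f (z + u)) \<le> exp (b * (\<bar>Im w1\<bar> + \<bar>Im w2\<bar>)) * pw_norm f" by linarith
      with q0 have "pw_norm (\<lambda>u. f (z + u)) * q \<le> exp (b * (\<bar>Im w1\<bar> + \<bar>Im w2\<bar>)) * pw_norm f * q"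
        by (rule mult_right_mono[rotated])
      with corr[of z] show ?thesis by linarith
    qed
  qed (use S K q0 w hol' in \<open>auto simp: S_def intro: holomorphic_on_subset holomorphic_on_imp_continuous_on\<close>)
  then show "norm (window_correlation R h f w) \<le> ?K * sqrt (integral {-R..R} (\<lambda>t. (norm (h t))\<^sup>2))"
    unfolding q_def .
qed

lemma pw_norm_zero: "pw_norm (\<lambda>z. 0) = 0"
  using pw_norm_scale[of 0] by simp

text \<open>Continuity excludes exceptional null sets: the continuous nonnegative integrand has
  integral 0 over a nondegenerate interval containing \<open>t\<close>.\<close>

lemma pw_norm_eq_0_imp:
  assumes f: "continuous_on UNIV f" and int: "square_integrable_on_line f" and 0: "pw_norm f = 0"
  shows "f (of_real t) = 0"
proof -
  define R where "R = \<bar>t\<bar> + 1"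
  define g where "g = (\<lambda>t. (norm (f (0 + complex_of_real t)))\<^sup>2)"
  have g: "continuous_on {-R..R} g"
    unfolding g_def by (intro continuous_intros continuous_on_line f)
  have "integral {-R..R} g \<le> 0"
    unfolding g_def using integral_window_le_pw_norm[OF f, of 0 R] int 0 by simp
  moreover have "0 \<le> integral {-R..R} g"
    by (intro integral_nonneg integrable_continuous_real g) (simp add: g_def)
  ultimately have "integral {-R..R} g = 0" by linarith
  then have "\<forall>x\<in>{-R..R}. g x = 0"
    using integral_eq_0_iff[OF g] unfolding R_def by (auto simp: g_def)
  moreover have "t \<in> {-R..R}" by (auto simp: R_def)
  ultimately have "g t = 0" by blast
  then show ?thesis unfolding g_def by simp
qed

subsection \<open>Paley-Wiener spaces\<close>

lemma paley_wiener_continuous: "f \<in> paley_wiener a \<Longrightarrow> continuous_on UNIV f"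
  unfolding paley_wiener_def by (auto intro: holomorphic_on_imp_continuous_on)

lemma paley_wiener_growth:
  assumes "f \<in> paley_wiener a" "a < b"
  obtains C where "\<And>z. norm (f z) \<le> C * exp (b * norm z)"
proof -
  have "b - a > 0" "exponential_type_le a f" using assms by (auto simp: paley_wiener_def)
  then obtain C where "\<forall>z. norm (f z) \<le> C * exp ((a + (b - a)) * norm z)"
    unfolding exponential_type_le_def by blast
  then have "\<And>z. norm (f z) \<le> C * exp (b * norm z)" by simp
  then show ?thesis by (rule that)
qed

lemma paley_wiener_mono:
  assumes "f \<in> paley_wiener a" "a \<le> b"
  shows "f \<in> paley_wiener b"
proof -
  have "exponential_type_le b f"
    unfolding exponential_type_le_def
  proof (intro allI impI)
    fix e :: real assume "e > 0"
    then show "\<exists>C. \<forall>z. norm (f z) \<le> C * exp ((b + e) * norm z)"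
      using paley_wiener_growth[OF assms(1), of "b + e"] assms(2) by fastforce
  qed
  then show ?thesis using assms(1) by (simp add: paley_wiener_def)
qed

lemma paley_wiener_scale:
  assumes "f \<in> paley_wiener a"
  shows "(\<lambda>z. k * f z) \<in> paley_wiener a"
proof -
  have "exponential_type_le a (\<lambda>z. k * f z)"
    unfolding exponential_type_le_def
  proof (intro allI impI)
    fix e :: real assume "e > 0"
    then obtain C where C: "\<And>z. norm (f z) \<le> C * exp ((a + e) * norm z)"
      using paley_wiener_growth[OF assms, of "a + e"] by auto
    have "norm (k * f z) \<le> (norm k * C) * exp ((a + e) * norm z)" for z
      using mult_left_mono[OF C, of "norm k"] by (simp add: norm_mult mult.assoc)
    then show "\<exists>C. \<forall>z. norm (k * f z) \<le> C * exp ((a + e) * norm z)" by blast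
  qed
  then show ?thesis using assms
    by (auto simp: paley_wiener_def norm_mult power_mult_distrib intro!: holomorphic_intros)
qed

lemma paley_wiener_add:
  assumes f: "f \<in> paley_wiener a" and g: "g \<in> paley_wiener a"
  shows "(\<lambda>z. f z + g z) \<in> paley_wiener a"
proof -
  have "exponential_type_le a (\<lambda>z. f z + g z)"
    unfolding exponential_type_le_def
  proof (intro allI impI)
    fix e :: real assume e: "e > 0"
    obtain C where C: "\<And>z. norm (f z) \<le> C * exp ((a + e) * norm z)"
      using paley_wiener_growth[OF f, of "a + e"] e by auto
    obtain D where D: "\<And>z. norm (g z) \<le> D * exp ((a + e) * norm z)"
      using paley_wiener_growth[OF g, of "a + e"] e by auto
    have "norm (f z + g z) \<le> (C + D) * exp ((a + e) * norm z)" for z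
      using norm_triangle_ineq[of "f z" "g z"] C[of z] D[of z] by (simp add: distrib_right)
    then show "\<exists>C. \<forall>z. norm (f z + g z) \<le> C * exp ((a + e) * norm z)" by blast
  qed
  moreover have "square_integrable_on_line (\<lambda>z. f z + g z)"
    using f g by (intro pw_norm_add_le paley_wiener_continuous[OF f] paley_wiener_continuous[OF g])
      (auto simp: paley_wiener_def)
  ultimately show ?thesis using f g by (auto simp: paley_wiener_def intro!: holomorphic_intros)
qed

lemma paley_wiener_diff:
  assumes "f \<in> paley_wiener a" "g \<in> paley_wiener a"
  shows "(\<lambda>z. f z - g z) \<in> paley_wiener a"
  using paley_wiener_add[OF assms(1) paley_wiener_scale[OF assms(2), of "-1"]] by simp

lemma pw_norm_le_diff:
  assumes f: "f \<in> paley_wiener a" and g: "g \<in> paley_wiener a"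
  shows "(pw_norm g)\<^sup>2 \<le> 2 * (pw_norm (\<lambda>z. f z - g z))\<^sup>2 + 2 * (pw_norm f)\<^sup>2"
proof -
  have gf: "(\<lambda>z. -1 * (f z - g z)) \<in> paley_wiener a"
    by (rule paley_wiener_scale[OF paley_wiener_diff[OF f g]])
  have "(pw_norm (\<lambda>z. -1 * (f z - g z) + f z))\<^sup>2
      \<le> 2 * (pw_norm (\<lambda>z. -1 * (f z - g z)))\<^sup>2 + 2 * (pw_norm f)\<^sup>2"
    using gf f by (intro pw_norm_add_le(2) paley_wiener_continuous[OF gf] paley_wiener_continuous[OF f])
      (auto simp: paley_wiener_def)
  then show ?thesis unfolding pw_norm_scale by simp
qed

text \<open>The rate \<open>b\<close> lies strictly above \<open>a\<close> because type at most
  \<open>a\<close> supplies a growth constant only for such rates.\<close>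

lemma paley_wiener_translate_norm:
  assumes f: "f \<in> paley_wiener a" and b: "0 \<le> b" "a < b"
  shows "square_integrable_on_line (\<lambda>z. f (w + z))"
    and "pw_norm (\<lambda>z. f (w + z)) \<le> exp (b * \<bar>Im w\<bar>) * pw_norm f"
proof -
  obtain C where "\<And>z. norm (f z) \<le> C * exp (b * norm z)"
    using paley_wiener_growth[OF f b(2)] by blast
  then show "square_integrable_on_line (\<lambda>z. f (w + z))"
    and "pw_norm (\<lambda>z. f (w + z)) \<le> exp (b * \<bar>Im w\<bar>) * pw_norm f"
    using f b(1) by (auto simp: paley_wiener_def intro!: plancherel_polya)
qed

text \<open>The precise type \<open>\<bar>c\<bar> * a\<close> is what makes the range proper for
  \<open>\<bar>c\<bar> < 1\<close>. As \<open>d\<close> may be complex, square integrability rests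
  on the Plancherel-Polya inequality and not just on a change of variables.\<close>

lemma paley_wiener_affine:
  assumes f: "f \<in> paley_wiener a" and a: "0 \<le> a" and c: "c \<noteq> 0"
  shows "(\<lambda>z. f (of_real c * z + d)) \<in> paley_wiener (\<bar>c\<bar> * a)"
proof -
  have hol: "(\<lambda>z. f (of_real c * z + d)) holomorphic_on UNIV"
    by (rule holomorphic_on_compose_gen[of _ _ f UNIV, unfolded o_def])
      (use f in \<open>auto simp: paley_wiener_def intro!: holomorphic_intros\<close>)
  have "exponential_type_le (\<bar>c\<bar> * a) (\<lambda>z. f (of_real c * z + d))"
    unfolding exponential_type_le_def
  proof (intro allI impI)
    fix e :: real assume e: "e > 0"
    \<comment> \<open>Chosen so that \<open>b * \<bar>c\<bar>\<close> is the target rate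
      \<open>\<bar>c\<bar> * a + e\<close>.\<close>
    define b where "b = a + e / \<bar>c\<bar>"
    have b: "a < b" "0 \<le> b" using e c a by (auto simp: b_def)
    have bc: "b * \<bar>c\<bar> = \<bar>c\<bar> * a + e" using c by (simp add: b_def field_simps)
    obtain C where C: "\<And>z. norm (f z) \<le> C * exp (b * norm z)"
      using paley_wiener_growth[OF f b(1)] by blast
    have C0: "0 \<le> C" using C[of 0] norm_ge_zero[of "f 0"] by (simp del: norm_ge_zero)
    have "norm (f (of_real c * z + d)) \<le> (C * exp (b * norm d)) * exp ((\<bar>c\<bar> * a + e) * norm z)" for z
    proof -
      have "norm (of_real c * z + d) \<le> norm (of_real c * z) + norm d" by (rule norm_triangle_ineq)
      then have "b * norm (of_real c * z + d) \<le> b * (\<bar>c\<bar> * norm z + norm d)"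
        using b(2) by (intro mult_left_mono) (auto simp: norm_mult)
      also have "\<dots> = b * norm d + (\<bar>c\<bar> * a + e) * norm z"
        unfolding bc[symmetric] by (simp add: algebra_simps)
      finally have "C * exp (b * norm (of_real c * z + d)) \<le> C * exp (b * norm d + (\<bar>c\<bar> * a + e) * norm z)"
        using C0 by (intro mult_left_mono) auto
      also have "\<dots> = (C * exp (b * norm d)) * exp ((\<bar>c\<bar> * a + e) * norm z)"
        by (simp only: exp_add mult.assoc)
      finally show ?thesis using C[of "of_real c * z + d"] by linarith
    qed
    then show "\<exists>C. \<forall>z. norm (f (of_real c * z + d)) \<le> C * exp ((\<bar>c\<bar> * a + e) * norm z)" by blast
  qed
  moreover have "square_integrable_on_line (\<lambda>z. f (d + (of_real 0 + of_real c * z)))"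
    using paley_wiener_translate_norm(1)[OF f, of "a + 1" d] a
    by (subst square_integrable_affine_iff[OF c, of "\<lambda>z. f (d + z)"]) auto
  ultimately show ?thesis using hol by (simp add: paley_wiener_def add.commute)
qed

lemma paley_wiener_contract:
  assumes "f \<in> paley_wiener a" "0 \<le> a" "c \<noteq> 0" "\<bar>c\<bar> \<le> 1"
  shows "(\<lambda>z. f (of_real c * z + d)) \<in> paley_wiener a"
  using paley_wiener_mono[OF paley_wiener_affine[OF assms(1,2,3)]] assms(2,4)
  by (simp add: mult_left_le_one_le)

section \<open>The sinc function as a test function of exact exponential type\<close>

definition csinc :: "complex \<Rightarrow> complex" where
  "csinc z = (if z = 0 then 1 else sin z / z)"

lemma csinc_minus: "csinc (- z) = csinc z"
  by (simp add: csinc_def)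

lemma csinc_holomorphic: "csinc holomorphic_on UNIV"
proof -
  have "((\<lambda>z::complex. sin z / z) \<longlongrightarrow> 1) (at 0)"
    using DERIV_sin[of "0::complex"] by (simp add: DERIV_def)
  then have "(\<lambda>z. if z = 0 then 1 else sin z / z) holomorphic_on (UNIV :: complex set)"
    by (intro removable_singularity holomorphic_intros) auto
  then show ?thesis by (simp add: csinc_def[abs_def])
qed

text \<open>Compactness bounds the function on the unit disc; outside it, division by z only
  decreases the modulus of the sine, which is at most \<open>exp (norm z)\<close>. On the line the
  square is dominated by a multiple of 1 / (1 + t^2).\<close>

lemma csinc_in_paley_wiener_1: "csinc \<in> paley_wiener 1"
proof -
  have cont: "continuous_on UNIV csinc" by (rule holomorphic_on_imp_continuous_on[OF csinc_holomorphic])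
  have "compact (csinc ` cball 0 1)"
    by (intro compact_continuous_image continuous_on_subset[OF cont]) auto
  then obtain K where "\<forall>x\<in>csinc ` cball 0 1. norm x \<le> K"
    using compact_imp_bounded bounded_iff by metis
  then have K: "norm (csinc z) \<le> K" if "norm z \<le> 1" for z using that by auto
  have K0: "0 \<le> K" using K[of 0] norm_ge_zero[of "csinc 0"] by (simp del: norm_ge_zero)
  have "exponential_type_le 1 csinc"
    unfolding exponential_type_le_def
  proof (intro allI impI)
    fix e :: real assume e: "e > 0"
    have "norm (csinc z) \<le> (K + 1) * exp ((1 + e) * norm z)" for z
    proof (cases "norm z \<le> 1")
      case True
      have "K * 1 \<le> (K + 1) * exp ((1 + e) * norm z)" using K0 e by (intro mult_mono) auto
      then show ?thesis using K[OF True] by simp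
    next
      case False
      then have z: "z \<noteq> 0" "1 \<le> norm z" by auto
      have "norm (sin z) = norm (exp (\<i> * z) - exp (- (\<i> * z))) / 2"
        unfolding sin_exp_eq by (simp only: norm_divide norm_mult norm_ii norm_numeral mult_1_right)
      also have "\<dots> \<le> (norm (exp (\<i> * z)) + norm (exp (- (\<i> * z)))) / 2"
        by (intro divide_right_mono norm_triangle_ineq4) auto
      also have "\<dots> \<le> (exp (norm (\<i> * z)) + exp (norm (- (\<i> * z)))) / 2"
        by (intro divide_right_mono add_mono norm_exp) auto
      also have "\<dots> = exp (norm z)" by (simp add: norm_mult)
      finally have "norm (sin z) / norm z \<le> exp (norm z) / 1" using z(2) by (intro frac_le) auto
      moreover have "exp (norm z) \<le> exp ((1 + e) * norm z)" using e by (simp add: distrib_right)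
      moreover have "1 * exp ((1 + e) * norm z) \<le> (K + 1) * exp ((1 + e) * norm z)"
        using K0 by (intro mult_right_mono) auto
      moreover have "norm (csinc z) = norm (sin z) / norm z" using z by (simp add: csinc_def norm_divide)
      ultimately show ?thesis by linarith
    qed
    then show "\<exists>C. \<forall>z. norm (csinc z) \<le> C * exp ((1 + e) * norm z)" by blast
  qed
  moreover have "square_integrable_on_line csinc"
  proof (rule Bochner_Integration.integrable_bound)
    have "integrable lborel (\<lambda>x::real. inverse (1 + x\<^sup>2))"
      using integrable_inverse_1_plus_square by (simp add: set_integrable_def)
    then show "integrable lborel (\<lambda>x::real. (2 * K\<^sup>2 + 2) * inverse (1 + x\<^sup>2))" by simp
    have "continuous_on UNIV (\<lambda>t. csinc (0 + complex_of_real t))" by (rule continuous_on_line[OF cont])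
    then have "(\<lambda>t. (norm (csinc (complex_of_real t)))\<^sup>2) \<in> borel_measurable borel"
      by (intro borel_measurable_continuous_onI continuous_intros) auto
    then show "(\<lambda>t. (norm (csinc (complex_of_real t)))\<^sup>2) \<in> borel_measurable lborel" by simp
    have "(norm (csinc (complex_of_real t)))\<^sup>2 * (1 + t\<^sup>2) \<le> 2 * K\<^sup>2 + 2" for t
    proof (cases "\<bar>t\<bar> \<le> 1")
      case True
      then have "t\<^sup>2 \<le> 1" by (simp add: abs_square_le_1)
      moreover have "(norm (csinc (complex_of_real t)))\<^sup>2 \<le> K\<^sup>2"
        using K[of "of_real t"] True by (intro power_mono) auto
      ultimately have "(norm (csinc (complex_of_real t)))\<^sup>2 * (1 + t\<^sup>2) \<le> K\<^sup>2 * 2"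
        by (intro mult_mono) auto
      then show ?thesis by simp
    next
      case False
      then have t: "t \<noteq> 0" "1 \<le> t\<^sup>2" using abs_le_square_iff[of 1 t] by auto
      have "norm (csinc (complex_of_real t)) = \<bar>sin t\<bar> / \<bar>t\<bar>"
        using t by (simp add: csinc_def norm_divide sin_of_real)
      then have "(norm (csinc (complex_of_real t)))\<^sup>2 = (sin t)\<^sup>2 / t\<^sup>2" by (simp add: power_divide)
      also have "\<dots> \<le> 1 / t\<^sup>2" by (intro divide_right_mono) (auto simp: abs_square_le_1)
      finally have "(norm (csinc (complex_of_real t)))\<^sup>2 * (1 + t\<^sup>2) \<le> 1 / t\<^sup>2 * (1 + t\<^sup>2)"
        by (intro mult_right_mono) auto
      also have "\<dots> \<le> 2" using t by (simp add: field_simps)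
      finally show ?thesis using zero_le_power2[of K] by linarith
    qed
    moreover have "1 + t\<^sup>2 > 0" for t :: real by (simp add: add_pos_nonneg)
    ultimately show "AE t in lborel. norm ((norm (csinc (complex_of_real t)))\<^sup>2)
        \<le> norm ((2 * K\<^sup>2 + 2) * inverse (1 + t\<^sup>2))"
      by (auto simp: divide_inverse[symmetric] pos_le_divide_eq abs_mult)
  qed
  ultimately show ?thesis using csinc_holomorphic by (simp add: paley_wiener_def)
qed

lemma csinc_in_paley_wiener: "a > 0 \<Longrightarrow> (\<lambda>z. csinc (of_real a * z + d)) \<in> paley_wiener a"
  using paley_wiener_affine[OF csinc_in_paley_wiener_1, of a d] by simp

text \<open>At the point i y the function equals sinh (a y) / (a y), which outgrows C exp (b' y) for
  every b' below \<open>a\<close>.\<close>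

lemma csinc_not_in_smaller_paley_wiener:
  assumes b: "0 \<le> b" "b < a"
  shows "(\<lambda>z. csinc (of_real a * z)) \<notin> paley_wiener b"
proof
  assume mem: "(\<lambda>z. csinc (of_real a * z)) \<in> paley_wiener b"
  define b' where "b' = (a + b) / 2"
  have b': "b < b'" "b' < a" "0 < b'" using b by (auto simp: b'_def)
  obtain C where C: "\<And>z. norm (csinc (of_real a * z)) \<le> C * exp (b' * norm z)"
    using paley_wiener_growth[OF mem b'(1)] by blast
  have C0: "0 \<le> C" using C[of 0] norm_ge_zero[of "csinc 0"] by (simp del: norm_ge_zero)
  define k where "k = a - b'"
  have k: "k > 0" using b' by (simp add: k_def)
  \<comment> \<open>For this y the quadratic Taylor term \<open>(k * y)\<^sup>2 / 2\<close> equals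
    \<open>2 * a * C * y + y / 2\<close>, hence exceeds the linear term
    \<open>2 * a * C * y\<close>.\<close>
  define y where "y = (4 * a * C + 1) / k\<^sup>2"
  have y: "y > 0" unfolding y_def using k b b' C0 by (intro divide_pos_pos add_nonneg_pos) auto
  have ay: "a * y > 0" using y b b' by simp
  have "norm (csinc (of_real a * (\<i> * of_real y))) = (exp (a * y) - exp (- (a * y))) / (2 * (a * y))"
  proof -
    define W where "W = complex_of_real (a * y)"
    have W: "W \<noteq> 0" "norm W = a * y" using ay unfolding W_def norm_of_real by auto
    have "exp (- W) - exp W = of_real (exp (- (a * y)) - exp (a * y))"
      unfolding W_def by (metis exp_of_real of_real_diff of_real_minus)
    then have "norm (exp (- W) - exp W) = exp (a * y) - exp (- (a * y))"
      using ay by (simp only: norm_of_real) simp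
    moreover have "csinc (\<i> * W) = (exp (- W) - exp W) / (2 * \<i>) / (\<i> * W)"
      using W(1) by (simp add: csinc_def sin_exp_eq)
    moreover have "of_real a * (\<i> * of_real y) = \<i> * W" by (simp add: W_def algebra_simps)
    ultimately show ?thesis
      using W(2) by (simp only: norm_divide norm_mult norm_ii norm_numeral mult_1_left mult_1_right
          divide_divide_eq_left)
  qed
  moreover have "norm (\<i> * complex_of_real y) = y" using y by (simp add: norm_mult)
  ultimately have "(exp (a * y) - exp (- (a * y))) / (2 * (a * y)) \<le> C * exp (b' * y)"
    using C[of "\<i> * of_real y"] by simp
  then have "exp (a * y) - exp (- (a * y)) \<le> C * exp (b' * y) * (2 * (a * y))"
    using ay by (simp add: pos_divide_le_eq)
  moreover have "exp (- (a * y)) \<le> exp (b' * y)" 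
  proof -
    have "- (a * y) \<le> b' * y" using ay mult_pos_pos[OF b'(3) y] by linarith
    then show ?thesis by simp
  qed
  moreover have "exp (b' * y) * (1 + 2 * a * C * y) = exp (b' * y) + C * exp (b' * y) * (2 * (a * y))"
    by (simp add: algebra_simps)
  ultimately have "exp (a * y) \<le> exp (b' * y) * (1 + 2 * a * C * y)" by linarith
  moreover have "exp (a * y) = exp (b' * y) * exp (k * y)"
    by (simp add: k_def mult_exp_exp algebra_simps)
  ultimately have "exp (k * y) \<le> 1 + 2 * a * C * y" by simp
  moreover have "1 + k * y + (k * y)\<^sup>2 / 2 \<le> exp (k * y)"
    using k y by (intro exp_lower_Taylor_quadratic) auto
  moreover have "k * y > 0" using k y by simp
  ultimately have "(k * y)\<^sup>2 / 2 < 2 * a * C * y" by linarith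
  moreover have "(k * y)\<^sup>2 = (4 * a * C + 1) * y"
    using k by (simp add: y_def power_mult_distrib power2_eq_square)
  ultimately show False using y by (simp add: algebra_simps)
qed

lemma pw_norm_csinc_pos:
  assumes "a > 0"
  shows "0 < pw_norm (\<lambda>z. csinc (of_real a * z))"
proof -
  have m: "(\<lambda>z. csinc (of_real a * z)) \<in> paley_wiener a" using csinc_in_paley_wiener[OF assms, of 0] by simp
  have "pw_norm (\<lambda>z. csinc (of_real a * z)) \<noteq> 0"
    using pw_norm_eq_0_imp[OF paley_wiener_continuous[OF m], of 0] m
    by (auto simp: paley_wiener_def csinc_def)
  then show ?thesis using pw_norm_nonneg[of "\<lambda>z. csinc (of_real a * z)"] by linarith
qed

lemma composition_op_apply: "composition_op \<phi> f z = f (\<phi> z)"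
  by (simp add: composition_op_def)

lemma composition_op_affine_iterate:
  "(composition_op (\<lambda>z. of_real c * z + d) ^^ n) f
    = (\<lambda>z. f (of_real (c ^ n) * z + of_real (\<Sum>k<n. c ^ k) * d))"
proof (induction n)
  case (Suc n)
  show ?case
    by (simp only: funpow.simps o_apply Suc.IH) (simp add: composition_op_def fun_eq_iff algebra_simps)
qed simp

subsection \<open>Failure of shadowing\<close>

lemma positive_shadowingE:
  assumes "positive_shadowing E N T" "\<epsilon> > 0"
  obtains \<delta> where "\<delta> > 0"
    "\<And>x. (\<And>n. n \<ge> 1 \<Longrightarrow> x n \<in> E) \<Longrightarrow> (\<And>n. n \<ge> 1 \<Longrightarrow> N (T (x n) - x (n + 1)) \<le> \<delta>)
       \<Longrightarrow> \<exists>y\<in>E. \<forall>n\<ge>1. N ((T ^^ n) y - x n) \<le> \<epsilon>"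
  using assms unfolding positive_shadowing_def pseudo_orbit_def by (metis (no_types, lifting))

text \<open>
  The orbit of the shadowing point is small at times \<open>1\<close> and \<open>2 N + 1\<close>, where the
  pseudo-orbit vanishes; by the three lines inequality it is small at the peak \<open>N + 1\<close> too.
\<close>

lemma translation_not_shadowing:
  fixes d :: complex
  assumes a: "a > 0"
  shows "\<not> positive_shadowing (paley_wiener a) pw_norm (composition_op (\<lambda>z. z + d))"
proof
  let ?T = "composition_op (\<lambda>z. z + d)"
  assume "positive_shadowing (paley_wiener a) pw_norm ?T"
  from positive_shadowingE[OF this zero_less_one] obtain \<delta> :: real where \<delta>: "\<delta> > 0" and
    sh: "\<And>x. (\<And>n. n \<ge> 1 \<Longrightarrow> x n \<in> paley_wiener a) \<Longrightarrow> (\<And>n. n \<ge> 1 \<Longrightarrow> pw_norm (?T (x n) - x (n + 1)) \<le> \<delta>)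
       \<Longrightarrow> \<exists>y\<in>paley_wiener a. \<forall>n\<ge>1. pw_norm ((?T ^^ n) y - x n) \<le> 1" by blast
  \<comment> \<open>The slope of the tent: the translates below have norm at most
    \<open>exp 2\<close>, so a change of height by \<open>\<kappa>\<close> costs at most
    \<open>\<delta>\<close>.\<close>
  define \<kappa> where "\<kappa> = \<delta> / exp 2"
  have \<kappa>: "\<kappa> > 0" using \<delta> by (simp add: \<kappa>_def)
  \<comment> \<open>The peak height \<open>real N * \<kappa>\<close> must exceed 2, the bound that
    shadowing will impose on it.\<close>
  obtain N :: nat where N: "2 < real N * \<kappa>" using reals_Archimedean3[OF \<kappa>] by blast
  \<comment> \<open>The type is so small that \<open>N\<close> translations by \<open>d\<close>, in
    either direction, change the norm by a bounded factor only. The factor is \<open>exp 2\<close>,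
    since the norm estimate is used with the rate \<open>2 * b\<close>, above the type.\<close>
  define b where "b = min a (1 / (real N * \<bar>Im d\<bar> + 1))"
  have den: "real N * \<bar>Im d\<bar> + 1 > 0" by (simp add: add_nonneg_pos)
  have b: "0 < b" "b \<le> a" using a den by (auto simp: b_def)
  have bN: "b * (real N * \<bar>Im d\<bar>) \<le> 1"
  proof -
    have "b * (real N * \<bar>Im d\<bar>) \<le> 1 / (real N * \<bar>Im d\<bar> + 1) * (real N * \<bar>Im d\<bar>)"
      by (intro mult_right_mono) (auto simp: b_def)
    also have "\<dots> \<le> 1" using den by (simp add: field_simps)
    finally show ?thesis .
  qed
  define \<nu> where "\<nu> = pw_norm (\<lambda>z. csinc (of_real b * z))"
  have \<nu>: "\<nu> > 0" unfolding \<nu>_def using b(1) by (rule pw_norm_csinc_pos)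
  define u where "u = (\<lambda>z. complex_of_real (1 / \<nu>) * csinc (of_real b * z))"
  have ub: "u \<in> paley_wiener b"
    unfolding u_def using csinc_in_paley_wiener[OF b(1), of 0] by (intro paley_wiener_scale) simp
  have u1: "pw_norm u = 1" unfolding u_def pw_norm_scale \<nu>_def[symmetric] using \<nu> by (simp add: norm_divide)
  \<comment> \<open>The operator sends \<open>U k\<close> to \<open>U (k + 1)\<close>. The index is
    real to allow negative values.\<close>
  define U where "U = (\<lambda>(k::real) z. u (of_real k * d + z))"
  have U: "U k \<in> paley_wiener a" for k
    using paley_wiener_affine[OF ub, of 1 "of_real k * d"] b unfolding U_def
    by (auto simp: add.commute intro: paley_wiener_mono)
  have U_norm: "pw_norm (U k) \<le> exp 2" if k: "\<bar>k\<bar> \<le> real N" for k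
  proof -
    have "b * (\<bar>k\<bar> * \<bar>Im d\<bar>) \<le> b * (real N * \<bar>Im d\<bar>)"
      using k b by (intro mult_left_mono mult_right_mono) auto
    then have "(2 * b) * \<bar>Im (of_real k * d)\<bar> \<le> 2" using bN by (simp add: abs_mult)
    moreover have "pw_norm (U k) \<le> exp ((2 * b) * \<bar>Im (of_real k * d)\<bar>) * pw_norm u"
      unfolding U_def using b by (intro paley_wiener_translate_norm(2)[OF ub]) auto
    ultimately show ?thesis using u1 by (metis exp_le_cancel_iff mult.right_neutral order.trans)
  qed
  \<comment> \<open>The tent vanishes at 0 and \<open>2 * N\<close> and peaks at \<open>N\<close>.
    The operator moves the translate of \<open>X m\<close> to that of \<open>X (Suc m)\<close>, so a
    step only sees the difference of the heights.\<close>
  define \<tau> where "\<tau> = (\<lambda>m::nat. max 0 (real N - \<bar>real m - real N\<bar>))"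
  define X where "X = (\<lambda>m z. complex_of_real (\<kappa> * \<tau> m) * U (real m - real N) z)"
  have X: "X m \<in> paley_wiener a" for m unfolding X_def by (rule paley_wiener_scale[OF U])
  have step: "pw_norm (?T (X m) - X (Suc m)) \<le> \<delta>" for m
  proof -
    have "?T (X m) z - X (Suc m) z
        = complex_of_real (\<kappa> * (\<tau> m - \<tau> (Suc m))) * U (real (Suc m) - real N) z" for z
      by (simp add: composition_op_apply X_def U_def algebra_simps)
    then have eq: "pw_norm (?T (X m) - X (Suc m)) = \<kappa> * \<bar>\<tau> m - \<tau> (Suc m)\<bar> * pw_norm (U (real (Suc m) - real N))"
      unfolding fun_diff_def using \<kappa> by (simp only: pw_norm_scale norm_of_real abs_mult abs_of_pos)
    have "\<bar>\<tau> m - \<tau> (Suc m)\<bar> * pw_norm (U (real (Suc m) - real N)) \<le> 1 * exp 2"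
    proof (cases "Suc m \<le> 2 * N")
      case True
      then have "\<bar>real (Suc m) - real N\<bar> \<le> real N" by linarith
      moreover have "\<bar>\<tau> m - \<tau> (Suc m)\<bar> \<le> 1" unfolding \<tau>_def by (simp add: max_def abs_if)
      ultimately show ?thesis by (intro mult_mono U_norm) (auto simp: pw_norm_nonneg)
    \<comment> \<open>Beyond the tent both heights vanish, so the growing norms of the translates do
      no harm.\<close>
    next
      case False
      then have "\<tau> m = 0" "\<tau> (Suc m) = 0" unfolding \<tau>_def by (auto simp: max_def abs_if)
      then show ?thesis by simp
    qed
    then have "\<kappa> * (\<bar>\<tau> m - \<tau> (Suc m)\<bar> * pw_norm (U (real (Suc m) - real N))) \<le> \<kappa> * (1 * exp 2)"
      using \<kappa> by (intro mult_left_mono) auto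
    also have "\<dots> = \<delta>" by (simp add: \<kappa>_def)
    finally show ?thesis unfolding eq by (simp add: mult.assoc)
  qed
  have "\<exists>y\<in>paley_wiener a. \<forall>n\<ge>1. pw_norm ((?T ^^ n) y - X (n - 1)) \<le> 1"
  \<comment> \<open>Pseudo-orbits start at time 1, the tent at 0.\<close>
  proof (rule sh[where x = "\<lambda>n. X (n - 1)"])
    fix n :: nat assume "n \<ge> 1"
    then show "pw_norm (?T (X (n - 1)) - X (n + 1 - 1)) \<le> \<delta>" using step[of "n - 1"] by simp
  qed (rule X)
  then obtain y where y: "y \<in> paley_wiener a"
    and near: "\<And>n. n \<ge> 1 \<Longrightarrow> pw_norm ((?T ^^ n) y - X (n - 1)) \<le> 1" by blast
  define Y where "Y = (\<lambda>n z. y (of_nat n * d + z))"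
  have Tn: "(?T ^^ n) y = Y n" for n
    using composition_op_affine_iterate[where c = 1 and d = d and n = n and f = y]
    by (simp add: Y_def add.commute[of _ "of_nat n * d"])
  have Y: "Y n \<in> paley_wiener a" for n
    using paley_wiener_affine[OF y, of 1 "of_nat n * d"] a unfolding Y_def by (simp add: add.commute)
  have near': "pw_norm (\<lambda>z. Y (Suc m) z - X m z) \<le> 1" for m
    using near[of "Suc m"] unfolding Tn fun_diff_def by simp
  have small: "pw_norm (Y (Suc m)) \<le> 1" if "\<tau> m = 0" for m
    using near'[of m] that unfolding X_def by simp
  have "pw_norm (Y (Suc 0)) \<le> 1" "pw_norm (Y (Suc (2 * N))) \<le> 1"
    by (rule small, simp add: \<tau>_def)+
  moreover have "pw_norm (Y (Suc N)) \<le> max (pw_norm (Y (Suc 0))) (pw_norm (Y (Suc (2 * N))))"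
  proof -
    obtain C where C: "\<And>z. norm (y z) \<le> C * exp ((a + 1) * norm z)"
      using paley_wiener_growth[OF y, of "a + 1"] by auto
    have hol: "y holomorphic_on UNIV" and int: "square_integrable_on_line y"
      using y by (auto simp: paley_wiener_def)
    have mid: "pw_norm (Y (Suc N)) \<le> max (pw_norm (Y i)) (pw_norm (Y j))"
      if "Im (of_nat i * d) \<le> Im (of_nat (Suc N) * d)" "Im (of_nat (Suc N) * d) \<le> Im (of_nat j * d)" for i j
      unfolding Y_def using a by (intro pw_norm_three_lines[OF hol C _ int that]) auto
    show ?thesis
    \<comment> \<open>The sign of \<open>Im d\<close> decides which end of the orbit lies on the
      lower line.\<close>
    proof (cases "Im d \<ge> 0")
      case True
      then show ?thesis
        using mult_nonneg_nonneg[of "real N" "Im d"] by (intro mid) (simp_all add: algebra_simps)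
    next
      case False
      then have "pw_norm (Y (Suc N)) \<le> max (pw_norm (Y (Suc (2 * N)))) (pw_norm (Y (Suc 0)))"
        using mult_nonneg_nonpos[of "real N" "Im d"] by (intro mid) (simp_all add: algebra_simps)
      then show ?thesis by (simp add: max.commute)
    qed
  qed
  ultimately have "pw_norm (Y (Suc N)) \<le> 1" by linarith
  then have "(pw_norm (Y (Suc N)))\<^sup>2 \<le> 1" using pw_norm_nonneg by (simp add: power_le_one)
  moreover have "(pw_norm (\<lambda>z. Y (Suc N) z - X N z))\<^sup>2 \<le> 1"
    using near'[of N] pw_norm_nonneg by (simp add: power_le_one)
  ultimately have "(pw_norm (X N))\<^sup>2 \<le> 2\<^sup>2" using pw_norm_le_diff[OF Y[of "Suc N"] X[of N]] by simp
  then have "pw_norm (X N) \<le> 2" by (rule power2_le_imp_le) simp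
  moreover have "pw_norm (X N) = real N * \<kappa>"
    using \<kappa> u1 unfolding X_def pw_norm_scale by (simp add: \<tau>_def U_def norm_mult)
  ultimately show False using N by simp
qed

lemma reflection_not_shadowing:
  fixes d :: complex
  assumes a: "a > 0"
  shows "\<not> positive_shadowing (paley_wiener a) pw_norm (composition_op (\<lambda>z. - z + d))"
proof
  let ?T = "composition_op (\<lambda>z. - z + d)"
  assume "positive_shadowing (paley_wiener a) pw_norm ?T"
  from positive_shadowingE[OF this zero_less_one] obtain \<delta> :: real where \<delta>: "\<delta> > 0" and
    sh: "\<And>x. (\<And>n. n \<ge> 1 \<Longrightarrow> x n \<in> paley_wiener a) \<Longrightarrow> (\<And>n. n \<ge> 1 \<Longrightarrow> pw_norm (?T (x n) - x (n + 1)) \<le> \<delta>)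
       \<Longrightarrow> \<exists>y\<in>paley_wiener a. \<forall>n\<ge>1. pw_norm ((?T ^^ n) y - x n) \<le> 1" by blast
  \<comment> \<open>A sinc centred at \<open>d / 2\<close>, the fixed point of the reflection;
    evenness makes it invariant.\<close>
  define u where "u = (\<lambda>z. csinc (of_real a * z + - (of_real a * d / 2)))"
  have u: "u \<in> paley_wiener a" unfolding u_def by (rule csinc_in_paley_wiener[OF a])
  have Tu: "u (d - z) = u z" for z
    using csinc_minus[of "of_real a * z + - (of_real a * d / 2)"]
    by (simp add: u_def algebra_simps)
  have "pw_norm u \<noteq> 0"
  proof
    assume 0: "pw_norm u = 0"
    have "square_integrable_on_line u" using u by (simp add: paley_wiener_def)
    \<comment> \<open>The centre may lie off the real axis, so the zero norm is first carried to the
      line through it, where \<open>u\<close> takes the value 1.\<close>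
    then have "pw_norm (\<lambda>z. u (d / 2 + z)) \<le> 0" "square_integrable_on_line (\<lambda>z. u (d / 2 + z))"
      using paley_wiener_translate_norm[OF u, of "a + 1" "d / 2"] a 0 by auto
    then have "u (d / 2 + of_real 0) = 0"
      using paley_wiener_affine[OF u, of 1 "d / 2"] a pw_norm_nonneg[of "\<lambda>z. u (d / 2 + z)"]
      by (intro pw_norm_eq_0_imp) (auto simp: add.commute intro: paley_wiener_continuous)
    then show False by (simp add: u_def csinc_def)
  qed
  then have up: "0 < pw_norm u" using pw_norm_nonneg[of u] by linarith
  define k where "k = complex_of_real (\<delta> / pw_norm u)"
  have k: "norm k * pw_norm u = \<delta>" using up \<delta> by (simp add: k_def norm_divide)
  define x where "x = (\<lambda>(n::nat) z. of_nat n * k * u z)"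
  have x: "x n \<in> paley_wiener a" for n unfolding x_def by (rule paley_wiener_scale[OF u])
  have "\<exists>y\<in>paley_wiener a. \<forall>n\<ge>1. pw_norm ((?T ^^ n) y - x n) \<le> 1"
  proof (rule sh)
    fix n
    have "?T (x n) - x (n + 1) = (\<lambda>z. - k * u z)"
      by (simp add: fun_eq_iff composition_op_apply x_def Tu algebra_simps)
    then have "pw_norm (?T (x n) - x (n + 1)) = norm (- k) * pw_norm u" by (simp only: pw_norm_scale)
    then show "pw_norm (?T (x n) - x (n + 1)) \<le> \<delta>" using k by simp
  qed (rule x)
  then obtain y where y: "y \<in> paley_wiener a"
    and near: "\<And>n. n \<ge> 1 \<Longrightarrow> pw_norm ((?T ^^ n) y - x n) \<le> 1" by blast
  \<comment> \<open>At even times the orbit is back at \<open>y\<close>, while \<open>x\<close> has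
    grown without bound.\<close>
  have inv: "(?T ^^ (2 * m)) y = y" for m
    by (induction m) (simp_all add: composition_op_def o_def)
  obtain m :: nat where m: "1 + pw_norm y < real m * \<delta>" using reals_Archimedean3[OF \<delta>] by blast
  have m0: "m \<ge> 1" using m pw_norm_nonneg[of y] by (cases m) auto
  have "pw_norm (\<lambda>z. y z - x (2 * m) z) \<le> 1"
    using near[of "2 * m"] m0 unfolding inv fun_diff_def by simp
  then have "(pw_norm (\<lambda>z. y z - x (2 * m) z))\<^sup>2 \<le> 1" using pw_norm_nonneg by (simp add: power_le_one)
  with pw_norm_le_diff[OF y x, of "2 * m"] have "(pw_norm (x (2 * m)))\<^sup>2 \<le> 2 + 2 * (pw_norm y)\<^sup>2" by simp
  moreover have "pw_norm (x (2 * m)) = 2 * (real m * \<delta>)"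
    unfolding x_def pw_norm_scale norm_mult using k by (simp add: mult.assoc)
  moreover have "(2 * (1 + pw_norm y))\<^sup>2 \<le> (2 * (real m * \<delta>))\<^sup>2"
    using m pw_norm_nonneg[of y] by (intro power_mono) auto
  moreover have "2 + 2 * (pw_norm y)\<^sup>2 < (2 * (1 + pw_norm y))\<^sup>2"
  proof -
    have "(2 * (1 + pw_norm y))\<^sup>2 = 4 + 8 * pw_norm y + 4 * (pw_norm y)\<^sup>2"
      by (simp add: power2_eq_square algebra_simps)
    then show ?thesis using pw_norm_nonneg[of y] zero_le_power2[of "pw_norm y"] by linarith
  qed
  ultimately show False by simp
qed

text \<open>The pseudo-orbit rests at 0 at time 1, jumps to \<open>v\<close> at time 2 and follows
  the orbit of \<open>v\<close> from there. For a shadowing point \<open>y\<close>, the iterates of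
  \<open>y2 - v\<close> stay bounded by 1, where \<open>y2\<close> is the second iterate of
  \<open>y\<close>; this forces \<open>y2 = v\<close>. But \<open>y2\<close> has type at most
  \<open>\<bar>c\<bar> * a\<close>, whereas \<open>v\<close> is a multiple of a sinc of exact type
  \<open>a\<close>.\<close>

lemma contraction_not_shadowing:
  fixes d :: complex
  assumes a: "a > 0" and c: "c \<noteq> 0" "\<bar>c\<bar> < 1"
  shows "\<not> positive_shadowing (paley_wiener a) pw_norm (composition_op (\<lambda>z. of_real c * z + d))"
proof
  let ?T = "composition_op (\<lambda>z. of_real c * z + d)"
  assume "positive_shadowing (paley_wiener a) pw_norm ?T"
  from positive_shadowingE[OF this zero_less_one] obtain \<delta> :: real where \<delta>: "\<delta> > 0" and
    sh: "\<And>x. (\<And>n. n \<ge> 1 \<Longrightarrow> x n \<in> paley_wiener a) \<Longrightarrow> (\<And>n. n \<ge> 1 \<Longrightarrow> pw_norm (?T (x n) - x (n + 1)) \<le> \<delta>)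
       \<Longrightarrow> \<exists>y\<in>paley_wiener a. \<forall>n\<ge>1. pw_norm ((?T ^^ n) y - x n) \<le> 1" by blast
  define s where "s = (\<lambda>z. csinc (of_real a * z))"
  have s: "s \<in> paley_wiener a" unfolding s_def using csinc_in_paley_wiener[OF a, of 0] by simp
  have sp: "0 < pw_norm s" unfolding s_def by (rule pw_norm_csinc_pos[OF a])
  define k where "k = complex_of_real (\<delta> / pw_norm s)"
  have k: "norm k * pw_norm s = \<delta>" "k \<noteq> 0" using sp \<delta> by (auto simp: k_def norm_divide)
  define v where "v = (\<lambda>z. k * s z)"
  have v: "v \<in> paley_wiener a" unfolding v_def by (rule paley_wiener_scale[OF s])
  have T_in: "?T f \<in> paley_wiener a" if "f \<in> paley_wiener a" for f
    using paley_wiener_contract[OF that, of c d] a c by (simp add: composition_op_def o_def)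
  have T_zero: "?T (\<lambda>z. 0) = (\<lambda>z. 0)" by (simp add: composition_op_def o_def)
  define x where "x = (\<lambda>n::nat. if n \<le> 1 then (\<lambda>z. 0) else (?T ^^ (n - 2)) v)"
  have iter_in: "(?T ^^ n) v \<in> paley_wiener a" for n by (induction n) (simp_all add: v T_in)
  have zero_in: "(\<lambda>z. 0) \<in> paley_wiener a" using paley_wiener_scale[OF v, of 0] by simp
  have "\<exists>y\<in>paley_wiener a. \<forall>n\<ge>1. pw_norm ((?T ^^ n) y - x n) \<le> 1"
  proof (rule sh)
    show "x n \<in> paley_wiener a" for n by (simp add: x_def iter_in zero_in)
    fix n :: nat assume "n \<ge> 1"
    show "pw_norm (?T (x n) - x (n + 1)) \<le> \<delta>"
    proof (cases "n = 1")
      case True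
      have "?T (x n) - x (n + 1) = (\<lambda>z. (- k) * s z)"
        by (simp add: True x_def T_zero v_def fun_eq_iff)
      then have "pw_norm (?T (x n) - x (n + 1)) = norm (- k) * pw_norm s" by (simp only: pw_norm_scale)
      then show ?thesis using k by simp
    next
      case False
      with \<open>n \<ge> 1\<close> obtain j where "n = Suc (Suc j)" by (metis One_nat_def Suc_le_D le_SucE not_less_eq_eq)
      then have "?T (x n) - x (n + 1) = (\<lambda>z. 0)" by (simp add: x_def fun_eq_iff)
      then show ?thesis using \<delta> by (simp add: pw_norm_zero)
    qed
  qed
  then obtain y where y: "y \<in> paley_wiener a"
    and near: "\<And>n. n \<ge> 1 \<Longrightarrow> pw_norm ((?T ^^ n) y - x n) \<le> 1" by blast
  define y2 where "y2 = ?T (?T y)"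
  have Ty: "?T y \<in> paley_wiener a" by (rule T_in[OF y])
  have y2_small: "y2 \<in> paley_wiener (\<bar>c\<bar> * a)"
    unfolding y2_def using paley_wiener_affine[OF Ty _ c(1), of d] a by (simp add: composition_op_def o_def)
  have y2: "y2 \<in> paley_wiener a" unfolding y2_def by (rule T_in[OF Ty])
  define g where "g = (\<lambda>z. y2 z - v z)"
  have g: "g \<in> paley_wiener a" unfolding g_def by (rule paley_wiener_diff[OF y2 v])
  \<comment> \<open>A bound, uniform in n, for the geometric sums that multiply \<open>d\<close> in
    the iterates.\<close>
  define S where "S = 1 / (1 - \<bar>c\<bar>)"
  \<comment> \<open>An n-th iterate translates by \<open>e\<close> and dilates by
    \<open>c ^ n\<close>. The dilation divides the squared norm by \<open>\<bar>c\<bar> ^ n\<close>,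
    and translating back by \<open>- e\<close> costs a factor independent of n.\<close>
  have g_bound: "(pw_norm g)\<^sup>2 \<le> (exp (2 * a * (S * norm d)))\<^sup>2 * \<bar>c\<bar> ^ n" for n
  proof -
    define e where "e = of_real (\<Sum>i<n. c ^ i) * d"
    define G where "G = (\<lambda>z. g (e + z))"
    have "(?T ^^ (n + 2)) y - x (n + 2) = (\<lambda>z. (?T ^^ n) y2 z - (?T ^^ n) v z)"
      by (simp add: x_def y2_def fun_eq_iff funpow_add del: funpow.simps)
        (simp add: numeral_2_eq_2 funpow_swap1)
    also have "\<dots> = (\<lambda>z. G (of_real 0 + of_real (c ^ n) * z))"
      unfolding composition_op_affine_iterate G_def g_def e_def by (simp add: add.commute)
    finally have "pw_norm (\<lambda>z. G (of_real 0 + of_real (c ^ n) * z)) \<le> 1" using near[of "n + 2"] by simp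
    then have "(pw_norm (\<lambda>z. G (of_real 0 + of_real (c ^ n) * z)))\<^sup>2 \<le> 1"
      using pw_norm_nonneg by (simp add: power_le_one)
    then have G1: "(pw_norm G)\<^sup>2 \<le> \<bar>c\<bar> ^ n"
      using pw_norm_affine[of "c ^ n" G 0] c(1) by (simp add: power_abs mult_left_le)
    have "\<bar>\<Sum>i<n. c ^ i\<bar> \<le> (\<Sum>i<n. \<bar>c\<bar> ^ i)" by (rule order.trans[OF sum_abs]) (simp add: power_abs)
    also have "\<dots> \<le> S" unfolding S_def
      using c(2) by (simp add: sum_gp_strict divide_right_mono)
    finally have "norm e \<le> S * norm d" unfolding e_def norm_mult norm_of_real by (intro mult_right_mono) auto
    with abs_Im_le_cmod[of e] have Ie: "\<bar>Im e\<bar> \<le> S * norm d" by linarith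
    have Gin: "G \<in> paley_wiener a"
      unfolding G_def using paley_wiener_affine[OF g, of 1 e] a by (simp add: add.commute)
    have "pw_norm (\<lambda>z. G (- e + z)) \<le> exp (2 * a * \<bar>Im (- e)\<bar>) * pw_norm G"
      using a by (intro paley_wiener_translate_norm(2)[OF Gin]) auto
    also have "\<dots> \<le> exp (2 * a * (S * norm d)) * pw_norm G"
      using Ie a pw_norm_nonneg[of G] by (intro mult_right_mono) auto
    finally have "pw_norm g \<le> exp (2 * a * (S * norm d)) * pw_norm G" by (simp add: G_def)
    then have "(pw_norm g)\<^sup>2 \<le> (exp (2 * a * (S * norm d)) * pw_norm G)\<^sup>2"
      using pw_norm_nonneg by (intro power_mono) auto
    also have "\<dots> \<le> (exp (2 * a * (S * norm d)))\<^sup>2 * \<bar>c\<bar> ^ n"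
      unfolding power_mult_distrib using G1 by (intro mult_left_mono) auto
    finally show ?thesis .
  qed
  have "(\<lambda>n. (exp (2 * a * (S * norm d)))\<^sup>2 * \<bar>c\<bar> ^ n) \<longlonglongrightarrow> (exp (2 * a * (S * norm d)))\<^sup>2 * 0"
    using c(2) by (intro tendsto_intros LIMSEQ_power_zero) auto
  then have "(pw_norm g)\<^sup>2 \<le> (exp (2 * a * (S * norm d)))\<^sup>2 * 0"
    by (rule LIMSEQ_le_const) (use g_bound in auto)
  then have g0: "pw_norm g = 0" by simp
  \<comment> \<open>Translates of \<open>g\<close> have norm 0 as well, so \<open>g\<close> vanishes
    on every horizontal line and not only on the real axis.\<close>
  have "g w = 0" for w
  proof -
    have "pw_norm (\<lambda>z. g (w + z)) = 0"
      using paley_wiener_translate_norm(2)[OF g, of "2 * a" w] a g0 pw_norm_nonneg[of "\<lambda>z. g (w + z)"] by simp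
    moreover have "(\<lambda>z. g (w + z)) \<in> paley_wiener a"
      using paley_wiener_affine[OF g, of 1 w] a by (simp add: add.commute)
    ultimately have "g (w + of_real 0) = 0"
      by (intro pw_norm_eq_0_imp) (auto simp: paley_wiener_def intro: holomorphic_on_imp_continuous_on)
    then show ?thesis by simp
  qed
  then have "y2 = v" by (auto simp: g_def fun_eq_iff)
  then have "(\<lambda>z. inverse k * v z) \<in> paley_wiener (\<bar>c\<bar> * a)" using y2_small paley_wiener_scale by blast
  moreover have "(\<lambda>z. inverse k * v z) = s" using k(2) by (simp add: v_def fun_eq_iff)
  ultimately have "(\<lambda>z. csinc (of_real a * z)) \<in> paley_wiener (\<bar>c\<bar> * a)" by (simp add: s_def)
  then show False using csinc_not_in_smaller_paley_wiener[of "\<bar>c\<bar> * a" a] a c by simp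
qed

theorem theorem3p5:
  fixes a c :: real and d :: complex
  assumes "a > 0" and "0 < \<bar>c\<bar>" and "\<bar>c\<bar> \<le> 1"
  shows "\<not> positive_shadowing (paley_wiener a) pw_norm
             (composition_op (\<lambda>z. complex_of_real c * z + d))"
proof -
  consider "c = 1" | "c = -1" | "\<bar>c\<bar> < 1" using assms(3) by linarith
  then show ?thesis
  proof cases
    case 1
    then show ?thesis using translation_not_shadowing[OF assms(1), of d] by simp
  next
    case 2
    then show ?thesis using reflection_not_shadowing[OF assms(1), of d] by simp
  next
    case 3
    then show ?thesis using contraction_not_shadowing[OF assms(1), of c d] assms(2) by simp
  qed
qed

end
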